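(* Let $\mathbf{U}$ be a theory and let $\iota$ be an $m$-dimensional interpretation of $\mathbf{U}$ in $(\mathbb{N},+)$. Then for some $m'\le m$ there is an $m'$-dimensional non-relative interpretation $\kappa$ with absolute equality of $\mathbf{U}$ in $(\mathbb{N},+)$ which is definably isomorphic to $\iota$.
   Context: An $m$-dimensional translation $\iota$ from a signature $\Omega_1$ to $\{=,+\}$ consists of $\{=,+\}$-formulas $\mathit{Dom}_\iota(\bar y)$ ($\bar y$ an $m$-tuple), $\mathit{Pred}_{\iota,P}(\bar y_1,\dots,\bar y_n)$ for each $n$-ary predicate $P$ of $\Omega_1$ (including equality), and $\mathit{Fun}_{\iota,f}(\bar y_0,\dots,\bar y_n)$ for each $n$-ary function symbol $f$. It is an interpretation of an $\Omega_1$-structure $\mathfrak{A}$ (domain $A$) in $(\mathbb{N},+)$ if $\mathit{Dom}_\iota$ defines a nonempty $D\subseteq\mathbb{N}^m$, $\mathit{Pred}_{\iota,=}$ defines an equivalence $\sim$ on $D$, and there is a bijection $h:D/{\sim}\to A$ such that for all $\bar b_i\in D$: $\mathfrak{A}\models P(h([\bar b_1]),\dots,h([\bar b_n]))$ iff $(\mathbb{N},+)\models\mathit{Pred}_{\iota,P}(\bar b_1,\dots,\bar b_n)$, and $\mathfrak{A}\models h([\bar b_0])=f(h([\bar b_1]),\dots,h([\bar b_n]))$ iff $(\mathbb{N},+)\models\mathit{Fun}_{\iota,f}(\bar b_0,\dots,\bar b_n)$. It is an interpretation of a theory $\mathbf{U}$ in $(\mathbb{N},+)$ if it interprets some model of $\mathbf{U}$.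 $\iota$ is non-relative if $\mathit{Dom}_\iota(\bar y)$ is $\top$; it has absolute equality if $\mathit{Pred}_{\iota,=}(\bar y,\bar z)$ is $y_1=z_1\wedge\dots\wedge y_m=z_m$. If $\iota_1,\iota_2$ (dimensions $m_1,m_2$, domains $D_1,D_2$, equivalences $\sim_1,\sim_2$) interpret the same structure $\mathfrak{A}$ in $(\mathbb{N},+)$, a formula $I(\bar y,\bar z)$ defines an isomorphism between them if the bijections $h_1,h_2$ can be chosen so that $h_1([\bar b]_{\sim_1})=h_2([\bar c]_{\sim_2})$ iff $(\mathbb{N},+)\models I(\bar b,\bar c)$ for all $\bar b\in D_1,\bar c\in D_2$; they are definably isomorphic if such $I$ exists.
   Formalization: It is additionally assumed that D/∼, if finite, has exactly one element; otherwise the claim fails, since a non-relative interpretation with absolute equality has domain ℕ^k, which is infinite or a single point (k = 0 is allowed). *)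

theory Defs
  imports Main
begin

text \<open>First-order logic with equality over an arbitrary signature.  The symbols of a signature form
  sets rather than whole types, so that a signature may lack predicates or function symbols
  altogether.  Equality is a logical symbol, always present and always read as identity.\<close>

record ('f, 'p) signature =
  funs :: "'f set"
  fun_arity :: "'f \<Rightarrow> nat"
  preds :: "'p set"
  pred_arity :: "'p \<Rightarrow> nat"

datatype 'f tm = Var nat | App 'f "'f tm list"

datatype ('f, 'p) fm =
    Top
  | Eq "'f tm" "'f tm"
  | Rel 'p "'f tm list"
  | Neg "('f, 'p) fm"
  | Conj "('f, 'p) fm" "('f, 'p) fm"
  | Exists nat "('f, 'p) fm"

fun tm_of :: "('f, 'p) signature \<Rightarrow> 'f tm \<Rightarrow> bool" where
  "tm_of \<Omega> (Var i) \<longleftrightarrow> True"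
| "tm_of \<Omega> (App f ts) \<longleftrightarrow> f \<in> funs \<Omega> \<and> length ts = fun_arity \<Omega> f \<and> (\<forall>t\<in>set ts. tm_of \<Omega> t)"

fun fm_of :: "('f, 'p) signature \<Rightarrow> ('f, 'p) fm \<Rightarrow> bool" where
  "fm_of \<Omega> Top \<longleftrightarrow> True"
| "fm_of \<Omega> (Eq s t) \<longleftrightarrow> tm_of \<Omega> s \<and> tm_of \<Omega> t"
| "fm_of \<Omega> (Rel p ts) \<longleftrightarrow> p \<in> preds \<Omega> \<and> length ts = pred_arity \<Omega> p \<and> (\<forall>t\<in>set ts. tm_of \<Omega> t)"
| "fm_of \<Omega> (Neg \<phi>) \<longleftrightarrow> fm_of \<Omega> \<phi>"
| "fm_of \<Omega> (Conj \<phi> \<psi>) \<longleftrightarrow> fm_of \<Omega> \<phi> \<and> fm_of \<Omega> \<psi>"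
| "fm_of \<Omega> (Exists i \<phi>) \<longleftrightarrow> fm_of \<Omega> \<phi>"

fun tm_vars :: "'f tm \<Rightarrow> nat set" where
  "tm_vars (Var i) = {i}"
| "tm_vars (App f ts) = (\<Union>t\<in>set ts. tm_vars t)"

fun free_vars :: "('f, 'p) fm \<Rightarrow> nat set" where
  "free_vars Top = {}"
| "free_vars (Eq s t) = tm_vars s \<union> tm_vars t"
| "free_vars (Rel p ts) = (\<Union>t\<in>set ts. tm_vars t)"
| "free_vars (Neg \<phi>) = free_vars \<phi>"
| "free_vars (Conj \<phi> \<psi>) = free_vars \<phi> \<union> free_vars \<psi>"
| "free_vars (Exists i \<phi>) = free_vars \<phi> - {i}"

record ('a, 'f, 'p) struct =
  carrier :: "'a set"
  fun_interp :: "'f \<Rightarrow> 'a list \<Rightarrow> 'a"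
  pred_interp :: "'p \<Rightarrow> 'a list \<Rightarrow> bool"

definition struct_of :: "('f, 'p) signature \<Rightarrow> ('a, 'f, 'p) struct \<Rightarrow> bool" where
  "struct_of \<Omega> A \<longleftrightarrow> carrier A \<noteq> {} \<and>
     (\<forall>f\<in>funs \<Omega>. \<forall>xs. length xs = fun_arity \<Omega> f \<and> set xs \<subseteq> carrier A \<longrightarrow>
        fun_interp A f xs \<in> carrier A)"

fun tm_val :: "('a, 'f, 'p) struct \<Rightarrow> (nat \<Rightarrow> 'a) \<Rightarrow> 'f tm \<Rightarrow> 'a" where
  "tm_val A e (Var i) = e i"
| "tm_val A e (App f ts) = fun_interp A f (map (tm_val A e) ts)"

fun sat :: "('a, 'f, 'p) struct \<Rightarrow> (nat \<Rightarrow> 'a) \<Rightarrow> ('f, 'p) fm \<Rightarrow> bool" where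
  "sat A e Top \<longleftrightarrow> True"
| "sat A e (Eq s t) \<longleftrightarrow> tm_val A e s = tm_val A e t"
| "sat A e (Rel p ts) \<longleftrightarrow> pred_interp A p (map (tm_val A e) ts)"
| "sat A e (Neg \<phi>) \<longleftrightarrow> \<not> sat A e \<phi>"
| "sat A e (Conj \<phi> \<psi>) \<longleftrightarrow> sat A e \<phi> \<and> sat A e \<psi>"
| "sat A e (Exists i \<phi>) \<longleftrightarrow> (\<exists>x\<in>carrier A. sat A (e(i := x)) \<phi>)"

definition theory_of :: "('f, 'p) signature \<Rightarrow> ('f, 'p) fm set \<Rightarrow> bool" where
  "theory_of \<Omega> U \<longleftrightarrow> (\<forall>\<phi>\<in>U. fm_of \<Omega> \<phi> \<and> free_vars \<phi> = {})"

definition model_of ::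
    "('f, 'p) signature \<Rightarrow> ('f, 'p) fm set \<Rightarrow> ('a, 'f, 'p) struct \<Rightarrow> bool" where
  "model_of \<Omega> U A \<longleftrightarrow>
     struct_of \<Omega> A \<and> (\<forall>\<phi>\<in>U. \<forall>e. range e \<subseteq> carrier A \<longrightarrow> sat A e \<phi>)"


text \<open>The signature \<open>{=, +}\<close> and the structure \<open>(\<nat>, +)\<close>.\<close>

datatype plus_sym = Plus

type_synonym plus_fm = "(plus_sym, unit) fm"

definition plus_sig :: "(plus_sym, unit) signature" where
  "plus_sig = \<lparr>funs = {Plus}, fun_arity = (\<lambda>_. 2), preds = {}, pred_arity = (\<lambda>_. 0)\<rparr>"

definition nat_plus :: "(nat, plus_sym, unit) struct" where
  "nat_plus = \<lparr>carrier = UNIV, fun_interp = (\<lambda>_ xs. xs ! 0 + xs ! 1), pred_interp = (\<lambda>_ _. False)\<rparr>"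

text \<open>A formula in \<open>k\<close> variables has its free variables among the indices below \<open>k\<close>; tuples
  are lists, and an argument list of several tuples is their concatenation.  Thus in a formula
  \<open>\<phi>(y\<^sub>1, \<dots>, y\<^sub>n)\<close> on \<open>m\<close>-tuples, coordinate \<open>j\<close> of the \<open>i\<close>-th tuple (both counted from 0)
  is the variable \<open>i * m + j\<close>.\<close>

definition plus_fm_in :: "nat \<Rightarrow> plus_fm \<Rightarrow> bool" where
  "plus_fm_in k \<phi> \<longleftrightarrow> fm_of plus_sig \<phi> \<and> free_vars \<phi> \<subseteq> {..<k}"

text \<open>The default value 0 is irrelevant for formulas in \<open>length xs\<close> variables.\<close>

definition holds :: "plus_fm \<Rightarrow> nat list \<Rightarrow> bool" where
  "holds \<phi> xs \<longleftrightarrow> sat nat_plus (\<lambda>i. if i < length xs then xs ! i else 0) \<phi>"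


record ('f, 'p) translation =
  dim :: nat
  Dom :: plus_fm
  PredEq :: plus_fm
  Pred :: "'p \<Rightarrow> plus_fm"
  Fun :: "'f \<Rightarrow> plus_fm"

definition translation_of :: "('f, 'p) signature \<Rightarrow> ('f, 'p) translation \<Rightarrow> bool" where
  "translation_of \<Omega> \<iota> \<longleftrightarrow>
     plus_fm_in (dim \<iota>) (Dom \<iota>) \<and>
     plus_fm_in (2 * dim \<iota>) (PredEq \<iota>) \<and>
     (\<forall>p\<in>preds \<Omega>. plus_fm_in (pred_arity \<Omega> p * dim \<iota>) (Pred \<iota> p)) \<and>
     (\<forall>f\<in>funs \<Omega>. plus_fm_in (Suc (fun_arity \<Omega> f) * dim \<iota>) (Fun \<iota> f))"

definition dom_set :: "('f, 'p) translation \<Rightarrow> nat list set" where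
  "dom_set \<iota> = {b. length b = dim \<iota> \<and> holds (Dom \<iota>) b}"

definition eq_rel :: "('f, 'p) translation \<Rightarrow> (nat list \<times> nat list) set" where
  "eq_rel \<iota> = {(b, c). b \<in> dom_set \<iota> \<and> c \<in> dom_set \<iota> \<and> holds (PredEq \<iota>) (b @ c)}"

abbreviation eq_class :: "('f, 'p) translation \<Rightarrow> nat list \<Rightarrow> nat list set" where
  "eq_class \<iota> b \<equiv> eq_rel \<iota> `` {b}"

definition interprets_via ::
    "('f, 'p) signature \<Rightarrow> ('f, 'p) translation \<Rightarrow> ('a, 'f, 'p) struct \<Rightarrow> (nat list set \<Rightarrow> 'a) \<Rightarrow> bool" where
  "interprets_via \<Omega> \<iota> A h \<longleftrightarrow>
     translation_of \<Omega> \<iota> \<and> struct_of \<Omega> A \<and>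
     dom_set \<iota> \<noteq> {} \<and> equiv (dom_set \<iota>) (eq_rel \<iota>) \<and>
     bij_betw h (dom_set \<iota> // eq_rel \<iota>) (carrier A) \<and>
     (\<forall>p\<in>preds \<Omega>. \<forall>bs. length bs = pred_arity \<Omega> p \<and> set bs \<subseteq> dom_set \<iota> \<longrightarrow>
        (pred_interp A p (map (\<lambda>b. h (eq_class \<iota> b)) bs) \<longleftrightarrow> holds (Pred \<iota> p) (concat bs))) \<and>
     (\<forall>f\<in>funs \<Omega>. \<forall>b0 bs. b0 \<in> dom_set \<iota> \<and> length bs = fun_arity \<Omega> f \<and> set bs \<subseteq> dom_set \<iota> \<longrightarrow>
        (h (eq_class \<iota> b0) = fun_interp A f (map (\<lambda>b. h (eq_class \<iota> b)) bs) \<longleftrightarrow>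
         holds (Fun \<iota> f) (concat (b0 # bs))))"

definition interprets ::
    "('f, 'p) signature \<Rightarrow> ('f, 'p) translation \<Rightarrow> ('a, 'f, 'p) struct \<Rightarrow> bool" where
  "interprets \<Omega> \<iota> A \<longleftrightarrow> (\<exists>h. interprets_via \<Omega> \<iota> A h)"

text \<open>The type argument is the universe from which the elements of the interpreted structure are
  taken; HOL cannot quantify over it existentially inside a definition.\<close>

definition interpretation_of ::
    "'a itself \<Rightarrow> ('f, 'p) signature \<Rightarrow> ('f, 'p) fm set \<Rightarrow> ('f, 'p) translation \<Rightarrow> bool" where
  "interpretation_of (_ :: 'a itself) \<Omega> U \<iota> \<longleftrightarrow>
     (\<exists>A :: ('a, 'f, 'p) struct. model_of \<Omega> U A \<and> interprets \<Omega> \<iota> A)"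

definition non_relative :: "('f, 'p) translation \<Rightarrow> bool" where
  "non_relative \<iota> \<longleftrightarrow> Dom \<iota> = Top"

fun conj_list :: "('f, 'p) fm list \<Rightarrow> ('f, 'p) fm" where
  "conj_list [] = Top"
| "conj_list [\<phi>] = \<phi>"
| "conj_list (\<phi> # \<psi> # \<phi>s) = Conj \<phi> (conj_list (\<psi> # \<phi>s))"

definition absolute_equality :: "('f, 'p) translation \<Rightarrow> bool" where
  "absolute_equality \<iota> \<longleftrightarrow>
     PredEq \<iota> = conj_list (map (\<lambda>i. Eq (Var i) (Var (dim \<iota> + i))) [0..<dim \<iota>])"

definition defines_isomorphism ::
    "('f, 'p) signature \<Rightarrow> ('a, 'f, 'p) struct \<Rightarrow> plus_fm \<Rightarrow>
     ('f, 'p) translation \<Rightarrow> ('f, 'p) translation \<Rightarrow> bool" where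
  "defines_isomorphism \<Omega> A I \<iota>\<^sub>1 \<iota>\<^sub>2 \<longleftrightarrow>
     plus_fm_in (dim \<iota>\<^sub>1 + dim \<iota>\<^sub>2) I \<and>
     (\<exists>h\<^sub>1 h\<^sub>2. interprets_via \<Omega> \<iota>\<^sub>1 A h\<^sub>1 \<and> interprets_via \<Omega> \<iota>\<^sub>2 A h\<^sub>2 \<and>
        (\<forall>b\<in>dom_set \<iota>\<^sub>1. \<forall>c\<in>dom_set \<iota>\<^sub>2.
           h\<^sub>1 (eq_class \<iota>\<^sub>1 b) = h\<^sub>2 (eq_class \<iota>\<^sub>2 c) \<longleftrightarrow> holds I (b @ c)))"

definition definably_isomorphic ::
    "'a itself \<Rightarrow> ('f, 'p) signature \<Rightarrow> ('f, 'p) translation \<Rightarrow> ('f, 'p) translation \<Rightarrow> bool" where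
  "definably_isomorphic (_ :: 'a itself) \<Omega> \<iota>\<^sub>1 \<iota>\<^sub>2 \<longleftrightarrow>
     (\<exists>(A :: ('a, 'f, 'p) struct) I. defines_isomorphism \<Omega> A I \<iota>\<^sub>1 \<iota>\<^sub>2)"


text \<open>A non-relative interpretation with absolute equality has as many elements as some
  \<open>\<nat>\<^sup>k\<close>: it is infinite or, for \<open>k = 0\<close>, has exactly one element.  So it can be isomorphic to a
  given interpretation only if that one, too, is infinite or has exactly one element.\<close>

lemma sat_conj_list: "sat A e (conj_list \<phi>s) \<longleftrightarrow> (\<forall>\<phi>\<in>set \<phi>s. sat A e \<phi>)"
  by (induction \<phi>s rule: conj_list.induct) auto

lemma dom_set_non_relative:
  assumes "non_relative \<kappa>"
  shows "dom_set \<kappa> = {b. length b = dim \<kappa>}"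
  using assms by (simp add: dom_set_def non_relative_def holds_def)

lemma eq_rel_absolute_equality:
  assumes "absolute_equality \<kappa>"
  shows "eq_rel \<kappa> = Id_on (dom_set \<kappa>)"
proof -
  have "holds (PredEq \<kappa>) (b @ c) \<longleftrightarrow> b = c" if "length b = dim \<kappa>" "length c = dim \<kappa>" for b c
    using assms that
    by (auto simp: absolute_equality_def holds_def sat_conj_list nth_append list_eq_iff_nth_eq)
  then show ?thesis
    by (auto simp: eq_rel_def dom_set_def Id_on_def)
qed

lemma finite_definably_isomorphic:
  assumes iso: "definably_isomorphic TYPE('a) \<Omega> \<iota> \<kappa>"
    and \<kappa>: "non_relative \<kappa>" "absolute_equality \<kappa>"
    and fin: "finite (dom_set \<iota> // eq_rel \<iota>)"
  shows "card (dom_set \<iota> // eq_rel \<iota>) = 1"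
proof -
  let ?D = "{b :: nat list. length b = dim \<kappa>}"
  have "dom_set \<kappa> // eq_rel \<kappa> = (\<lambda>b. {b}) ` ?D"
    using \<kappa> by (auto simp: eq_rel_absolute_equality dom_set_non_relative quotient_def Id_on_def)
  then have bij: "bij_betw (\<lambda>b. {b}) ?D (dom_set \<kappa> // eq_rel \<kappa>)"
    by (simp add: bij_betw_def)
  from iso obtain A :: "('a, 'b, 'c) struct" and h\<^sub>1 h\<^sub>2
    where h: "bij_betw h\<^sub>1 (dom_set \<iota> // eq_rel \<iota>) (carrier A)"
      "bij_betw h\<^sub>2 (dom_set \<kappa> // eq_rel \<kappa>) (carrier A)"
    unfolding definably_isomorphic_def defines_isomorphism_def interprets_via_def by blast
  have fin_D: "finite ?D"
    using fin h bij by (metis bij_betw_finite)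
  have "dim \<kappa> = 0"
  proof (rule ccontr)
    assume "dim \<kappa> \<noteq> 0"
    then have "inj (\<lambda>n :: nat. replicate (dim \<kappa>) n)"
      by (auto simp: inj_on_def)
    moreover have "range (\<lambda>n :: nat. replicate (dim \<kappa>) n) \<subseteq> ?D"
      by auto
    ultimately show False
      using fin_D by (meson finite_subset infinite_UNIV_nat finite_imageD)
  qed
  then have "card ?D = 1"
    by simp
  then show ?thesis
    using h bij by (metis bij_betw_same_card)
qed

end

(*  A set of representatives is obtained by taking the lexicographically least element of every
    class, so everything reduces to a definable bijection between a definable set D of m-tuples and
    some N^k with k at most m, D being infinite or a singleton.

    By quantifier elimination (Cooper's algorithm), D is given by a Boolean combination of
    inequalities and divisibility conditions between affine functions.  Distinguishing whether a
    variable is zero, which of two variables is larger, and what the residue of a variable is modulo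
    a constant, one parametrizes the pieces of N^m again by coordinate subspaces N^S, injectively and
    affinely; after finitely many such steps every condition is constant on every piece.  Hence D is
    a finite disjoint union of definable copies of coordinate subspaces.  Finally a copy of N^j, with
    j at most k and k positive, is absorbed by N^k: by parity if j = k, by Hilbert's hotel if j < k. *)

theory Submission
  imports "HOL-Decision_Procs.Cooper" Defs
begin

(* Cooper comes before Defs in the imports: both declare fm, Eq and Neg, and the later import wins. *)

hide_const (open) Cooper.C Cooper.A Cooper.E Cooper.F Cooper.T

section \<open>Definable relations and functions\<close>

text \<open>The obstacle is that a piece of N^m cut out by linear inequalities is in general not
  parametrized by free coordinates. The case distinctions are chosen so that a substitution restores
  such coordinates each time: when two variables are compared, the larger is replaced by its excess
  over the smaller. A general inequality is brought into reach by a Euclidean algorithm on its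
  coefficients. The effect is that of Ito's theorem, by which semilinear sets are finite disjoint
  unions of linear sets with independent periods. No step introduces a new variable, which gives the
  bound on the dimension. Among the pieces only the largest dimension survives absorption. Pieces of
  dimension 0 are single points and cannot absorb each other; this is why finite quotients have to
  be restricted to one element. Definability is treated semantically, through relations on lists, so
  that hardly any formula has to be written down.\<close>

lemma tm_val_cong: "(\<And>v. v \<in> tm_vars t \<Longrightarrow> e v = e' v) \<Longrightarrow> tm_val A e t = tm_val A e' t"
proof (induction t)
  case (App f ts)
  have "map (tm_val A e) ts = map (tm_val A e') ts"
    using App by (auto intro!: map_cong)
  then show ?case by (simp del: map_eq_conv)
qed auto

lemma sat_cong: "(\<And>v. v \<in> free_vars \<phi> \<Longrightarrow> e v = e' v) \<Longrightarrow> sat A e \<phi> \<longleftrightarrow> sat A e' \<phi>"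
proof (induction \<phi> arbitrary: e e')
  case (Eq s t)
  then show ?case using tm_val_cong[of s e e' A] tm_val_cong[of t e e' A] by auto
next
  case (Rel p ts)
  have "map (tm_val A e) ts = map (tm_val A e') ts"
    using Rel by (auto intro!: map_cong tm_val_cong)
  then show ?case by (simp del: map_eq_conv)
next
  case (Neg \<phi>)
  then show ?case by (metis free_vars.simps(4) sat.simps(4))
next
  case (Conj \<phi> \<psi>)
  then show ?case by (metis UnI1 UnI2 free_vars.simps(5) sat.simps(5))
next
  case (Exists i \<phi>)
  have "sat A (e(i := x)) \<phi> \<longleftrightarrow> sat A (e'(i := x)) \<phi>" for x
    using Exists.prems by (intro Exists.IH) auto
  then show ?case by simp
qed auto

lemma finite_tm_vars: "finite (tm_vars t)"
  by (induction t) auto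

lemma finite_free_vars: "finite (free_vars \<phi>)"
  by (induction \<phi>) (auto simp: finite_tm_vars)

section \<open>Renaming of variables\<close>

fun rename_tm :: "(nat \<Rightarrow> nat) \<Rightarrow> 'f tm \<Rightarrow> 'f tm" where
  "rename_tm \<rho> (Var i) = Var (\<rho> i)"
| "rename_tm \<rho> (App f ts) = App f (map (rename_tm \<rho>) ts)"

lemma tm_of_rename_tm: "tm_of \<Omega> (rename_tm \<rho> t) \<longleftrightarrow> tm_of \<Omega> t"
  by (induction t) auto

lemma tm_vars_rename_tm: "tm_vars (rename_tm \<rho> t) = \<rho> ` tm_vars t"
  by (induction t) auto

lemma tm_val_rename_tm: "tm_val A e (rename_tm \<rho> t) = tm_val A (e \<circ> \<rho>) t"
proof (induction t)
  case (App f ts)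
  then have "map (tm_val A e \<circ> rename_tm \<rho>) ts = map (tm_val A (e \<circ> \<rho>)) ts"
    by (simp add: o_def cong: map_cong)
  then show ?case by (simp add: o_def del: map_eq_conv)
qed auto

text \<open>The renaming need not be injective, so bound variables may have to change as well.
  Stating only the existence of a renamed formula leaves their choice to the proof.\<close>

lemma rename_fm_exists:
  "fm_of \<Omega> \<phi> \<Longrightarrow>
   \<exists>\<phi>'. fm_of \<Omega> \<phi>' \<and> free_vars \<phi>' \<subseteq> \<rho> ` free_vars \<phi> \<and> (\<forall>e. sat A e \<phi>' \<longleftrightarrow> sat A (e \<circ> \<rho>) \<phi>)"
proof (induction \<phi> arbitrary: \<rho>)
  case Top
  then show ?case by (intro exI[of _ Top]) auto
next
  case (Eq s t)
  then show ?case
    by (intro exI[of _ "Eq (rename_tm \<rho> s) (rename_tm \<rho> t)"])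
      (use Eq in \<open>simp add: tm_of_rename_tm tm_vars_rename_tm tm_val_rename_tm image_Un o_def\<close>)
next
  case (Rel p ts)
  have *: "map (tm_val A e) (map (rename_tm \<rho>) ts) = map (tm_val A (e \<circ> \<rho>)) ts" for e
    by (simp add: tm_val_rename_tm)
  show ?case
  proof (intro exI conjI allI)
    show "fm_of \<Omega> (Rel p (map (rename_tm \<rho>) ts))"
      using Rel by (simp add: tm_of_rename_tm)
    show "free_vars (Rel p (map (rename_tm \<rho>) ts)) \<subseteq> \<rho> ` free_vars (Rel p ts)"
      by (auto simp: tm_vars_rename_tm)
    show "sat A e (Rel p (map (rename_tm \<rho>) ts)) \<longleftrightarrow> sat A (e \<circ> \<rho>) (Rel p ts)" for e
      by (simp only: sat.simps *)
  qed
next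
  case (Neg \<phi>)
  from Neg.prems have "fm_of \<Omega> \<phi>" by simp
  from Neg.IH[OF this] obtain \<phi>' where "fm_of \<Omega> \<phi>'" "free_vars \<phi>' \<subseteq> \<rho> ` free_vars \<phi>"
    "\<And>e. sat A e \<phi>' \<longleftrightarrow> sat A (e \<circ> \<rho>) \<phi>" by blast
  then show ?case by (intro exI[of _ "Neg \<phi>'"]) (auto simp: o_def)
next
  case (Conj \<phi> \<psi>)
  from Conj.prems have "fm_of \<Omega> \<phi>" "fm_of \<Omega> \<psi>" by simp_all
  from Conj.IH(1)[OF this(1)] Conj.IH(2)[OF this(2)] obtain \<phi>' \<psi>' where "fm_of \<Omega> \<phi>'" "free_vars \<phi>' \<subseteq> \<rho> ` free_vars \<phi>"
    "\<And>e. sat A e \<phi>' \<longleftrightarrow> sat A (e \<circ> \<rho>) \<phi>"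
    "fm_of \<Omega> \<psi>'" "free_vars \<psi>' \<subseteq> \<rho> ` free_vars \<psi>"
    "\<And>e. sat A e \<psi>' \<longleftrightarrow> sat A (e \<circ> \<rho>) \<psi>" by blast
  then show ?case by (intro exI[of _ "Conj \<phi>' \<psi>'"]) (auto simp: o_def)
next
  case (Exists i \<phi>)
  \<comment> \<open>Being distinct from the images of the other free variables, \<open>j\<close> can
    replace the bound variable \<open>i\<close> without capture.\<close>
  obtain j where j: "j \<notin> \<rho> ` (free_vars \<phi> - {i})"
    using ex_new_if_finite[of "\<rho> ` (free_vars \<phi> - {i})"] finite_free_vars[of \<phi>] by auto
  from Exists.prems have "fm_of \<Omega> \<phi>" by simp
  from Exists.IH[OF this] obtain \<phi>' where \<phi>': "fm_of \<Omega> \<phi>'" "free_vars \<phi>' \<subseteq> (\<rho>(i := j)) ` free_vars \<phi>"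
    "\<And>e. sat A e \<phi>' \<longleftrightarrow> sat A (e \<circ> \<rho>(i := j)) \<phi>" by blast
  have "sat A (e(j := x) \<circ> \<rho>(i := j)) \<phi> \<longleftrightarrow> sat A ((e \<circ> \<rho>)(i := x)) \<phi>" for e x
    using j by (intro sat_cong) auto
  then have "sat A e (Exists j \<phi>') \<longleftrightarrow> sat A (e \<circ> \<rho>) (Exists i \<phi>)" for e
    by (simp only: sat.simps \<phi>'(3))
  moreover have "free_vars (Exists j \<phi>') \<subseteq> \<rho> ` free_vars (Exists i \<phi>)"
    using \<phi>'(2) by (auto split: if_splits)
  ultimately show ?case
    using \<phi>'(1) by (metis fm_of.simps(6))
qed

section \<open>Closure properties of definable relations\<close>

text \<open>Relations on lists stand in for formulas, so that closure properties compose like set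
  operations. Lists of other lengths do not count, hence the length premises in the congruence
  rules.\<close>

definition definable :: "nat \<Rightarrow> (nat list \<Rightarrow> bool) \<Rightarrow> bool" where
  "definable n R \<longleftrightarrow>
     (\<exists>\<phi>. plus_fm_in n \<phi> \<and> (\<forall>xs. length xs = n \<longrightarrow> (holds \<phi> xs \<longleftrightarrow> R xs)))"

lemma definable_cong:
  "(\<And>xs. length xs = n \<Longrightarrow> R xs \<longleftrightarrow> S xs) \<Longrightarrow> definable n R \<longleftrightarrow> definable n S"
  unfolding definable_def by metis

lemma definable_congD:
  "definable n R \<Longrightarrow> (\<And>xs. length xs = n \<Longrightarrow> R xs \<longleftrightarrow> S xs) \<Longrightarrow> definable n S"
  using definable_cong by blast

lemma definable_holds: "plus_fm_in n \<phi> \<Longrightarrow> definable n (holds \<phi>)"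
  unfolding definable_def by blast

lemma definable_not: "definable n R \<Longrightarrow> definable n (\<lambda>xs. \<not> R xs)"
  unfolding definable_def
proof (elim exE)
  fix \<phi> assume "plus_fm_in n \<phi> \<and> (\<forall>xs. length xs = n \<longrightarrow> (holds \<phi> xs \<longleftrightarrow> R xs))"
  then show "\<exists>\<phi>. plus_fm_in n \<phi> \<and> (\<forall>xs. length xs = n \<longrightarrow> (holds \<phi> xs \<longleftrightarrow> \<not> R xs))"
    by (intro exI[of _ "Neg \<phi>"]) (auto simp: plus_fm_in_def holds_def)
qed

lemma definable_conj: "definable n R \<Longrightarrow> definable n S \<Longrightarrow> definable n (\<lambda>xs. R xs \<and> S xs)"
  unfolding definable_def
proof (elim exE)
  fix \<phi> \<psi> assume "plus_fm_in n \<phi> \<and> (\<forall>xs. length xs = n \<longrightarrow> (holds \<phi> xs \<longleftrightarrow> R xs))"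
    "plus_fm_in n \<psi> \<and> (\<forall>xs. length xs = n \<longrightarrow> (holds \<psi> xs \<longleftrightarrow> S xs))"
  then show "\<exists>\<phi>. plus_fm_in n \<phi> \<and> (\<forall>xs. length xs = n \<longrightarrow> (holds \<phi> xs \<longleftrightarrow> R xs \<and> S xs))"
    by (intro exI[of _ "Conj \<phi> \<psi>"]) (auto simp: plus_fm_in_def holds_def)
qed

lemma definable_const: "definable n (\<lambda>_. P)"
proof -
  have "definable n (\<lambda>_. True)"
    unfolding definable_def by (intro exI[of _ Top]) (auto simp: plus_fm_in_def holds_def)
  from this definable_not[OF this] show ?thesis by (cases P) auto
qed

lemma definable_disj: "definable n R \<Longrightarrow> definable n S \<Longrightarrow> definable n (\<lambda>xs. R xs \<or> S xs)"
  using definable_not[OF definable_conj[OF definable_not definable_not, of n R S]] by simp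

lemma definable_imp: "definable n R \<Longrightarrow> definable n S \<Longrightarrow> definable n (\<lambda>xs. R xs \<longrightarrow> S xs)"
  using definable_disj[OF definable_not, of n R S] by simp

lemma definable_ball:
  "finite I \<Longrightarrow> (\<And>i. i \<in> I \<Longrightarrow> definable n (R i)) \<Longrightarrow> definable n (\<lambda>xs. \<forall>i\<in>I. R i xs)"
  by (induction I rule: finite_induct) (auto intro: definable_const definable_conj)

lemma definable_all_less:
  "(\<And>i. i < k \<Longrightarrow> definable n (R i)) \<Longrightarrow> definable n (\<lambda>xs. \<forall>i<k. R i xs)" for k :: nat
  using definable_ball[of "{..<k}" n R] by (simp add: Ball_def)

lemma definable_nth_add:
  assumes "i < n" "j < n" "k < n"
  shows "definable n (\<lambda>xs. xs ! i = xs ! j + xs ! k)"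
  unfolding definable_def using assms
  by (intro exI[of _ "Eq (Var i) (App Plus [Var j, Var k])"])
    (auto simp: plus_fm_in_def holds_def plus_sig_def nat_plus_def)

lemma definable_nth_eq:
  assumes "i < n" "j < n"
  shows "definable n (\<lambda>xs. xs ! i = xs ! j)"
  unfolding definable_def using assms
  by (intro exI[of _ "Eq (Var i) (Var j)"]) (auto simp: plus_fm_in_def holds_def plus_sig_def)

text \<open>Variable \<open>i\<close> is renamed to \<open>is ! i\<close>. As \<open>is\<close> may
  repeat and permute indices, this one rule covers projections, swaps and identification of
  arguments.\<close>

lemma definable_select:
  assumes "definable (length is) R" "\<forall>i\<in>set is. i < n"
  shows "definable n (\<lambda>xs. R (map ((!) xs) is))"
proof -
  from assms(1) obtain \<phi> where \<phi>: "fm_of plus_sig \<phi>" "free_vars \<phi> \<subseteq> {..<length is}"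
    "\<And>xs. length xs = length is \<Longrightarrow> holds \<phi> xs \<longleftrightarrow> R xs"
    unfolding definable_def plus_fm_in_def by blast
  from rename_fm_exists[OF \<phi>(1), of "(!) is" nat_plus] obtain \<phi>' where \<phi>': "fm_of plus_sig \<phi>'"
    "free_vars \<phi>' \<subseteq> (!) is ` free_vars \<phi>" "\<And>e. sat nat_plus e \<phi>' \<longleftrightarrow> sat nat_plus (e \<circ> (!) is) \<phi>"
    by auto
  have nth: "is ! i < n" if "i < length is" for i
    using assms(2) that by simp
  have "holds \<phi>' xs \<longleftrightarrow> R (map ((!) xs) is)" if "length xs = n" for xs
  proof -
    have "holds \<phi>' xs \<longleftrightarrow> holds \<phi> (map ((!) xs) is)"
      unfolding holds_def \<phi>'(3) using \<phi>(2) nth that by (intro sat_cong) auto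
    then show ?thesis by (simp add: \<phi>(3))
  qed
  moreover have "free_vars \<phi>' \<subseteq> {..<n}"
    using \<phi>'(2) \<phi>(2) nth by fastforce
  ultimately show ?thesis
    unfolding definable_def plus_fm_in_def using \<phi>'(1) by blast
qed

lemma definable_ex1:
  assumes "definable (Suc n) R"
  shows "definable n (\<lambda>xs. \<exists>y. R (xs @ [y]))"
proof -
  from assms obtain \<phi> where \<phi>: "fm_of plus_sig \<phi>" "free_vars \<phi> \<subseteq> {..<Suc n}"
    "\<And>xs. length xs = Suc n \<Longrightarrow> holds \<phi> xs \<longleftrightarrow> R xs"
    unfolding definable_def plus_fm_in_def by blast
  have "holds (Exists n \<phi>) xs \<longleftrightarrow> (\<exists>y. R (xs @ [y]))" if "length xs = n" for xs
  proof -
    \<comment> \<open>Variable \<open>n\<close> is the first index beyond \<open>xs\<close>, so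
      assigning \<open>y\<close> to it gives the default-0 assignment of
      \<open>xs @ [y]\<close>.\<close>
    have "(\<lambda>i. if i < length xs then xs ! i else 0)(n := y) =
      (\<lambda>i. if i < length (xs @ [y]) then (xs @ [y]) ! i else 0)" for y
      using that by (auto simp: nth_append)
    then have "holds (Exists n \<phi>) xs \<longleftrightarrow> (\<exists>y. holds \<phi> (xs @ [y]))"
      unfolding holds_def by (simp add: nat_plus_def)
    then show ?thesis by (simp add: \<phi>(3) that)
  qed
  moreover have "plus_fm_in n (Exists n \<phi>)"
    using \<phi> by (auto simp: plus_fm_in_def less_Suc_eq subset_iff)
  ultimately show ?thesis unfolding definable_def by blast
qed

lemma definable_ex:
  "definable (n + k) R \<Longrightarrow> definable n (\<lambda>xs. \<exists>ys. length ys = k \<and> R (xs @ ys))"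
proof (induction k arbitrary: R)
  case (Suc k)
  have "definable n (\<lambda>xs. \<exists>ys. length ys = k \<and> (\<exists>y. R ((xs @ ys) @ [y])))"
    using Suc.IH[OF definable_ex1] Suc.prems by simp
  moreover have "(\<exists>ys. length ys = k \<and> (\<exists>y. R ((xs @ ys) @ [y]))) \<longleftrightarrow> (\<exists>ys. length ys = Suc k \<and> R (xs @ ys))" for xs
    by (metis (no_types, opaque_lifting) append.assoc length_append_singleton length_Suc_conv_rev)
  ultimately show ?case by simp
qed simp

section \<open>Definable functions, given by their graphs\<close>

text \<open>The value is the last coordinate of the graph. Terms of \<open>{=, +}\<close> denote
  only sums of variables, whereas graphs also admit constants and case distinctions.\<close>

definition dterm :: "nat \<Rightarrow> (nat list \<Rightarrow> nat) \<Rightarrow> bool" where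
  "dterm n t \<longleftrightarrow> definable (Suc n) (\<lambda>xs. xs ! n = t (take n xs))"

definition dmap :: "nat \<Rightarrow> nat \<Rightarrow> (nat list \<Rightarrow> nat list) \<Rightarrow> bool" where
  "dmap n k F \<longleftrightarrow> (\<forall>xs. length xs = n \<longrightarrow> length (F xs) = k) \<and> (\<forall>i<k. dterm n (\<lambda>xs. F xs ! i))"

lemma dterm_cong: "(\<And>xs. length xs = n \<Longrightarrow> t xs = s xs) \<Longrightarrow> dterm n t \<longleftrightarrow> dterm n s"
  unfolding dterm_def by (intro definable_cong) auto

lemma dterm_nth: "i < n \<Longrightarrow> dterm n (\<lambda>xs. xs ! i)"
  unfolding dterm_def using definable_nth_eq[of n "Suc n" i] by (simp add: less_Suc_eq)

lemma map_nth_drop: "map ((!) xs) [k..<n] = drop k xs" if "length xs = n"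
  using that by (intro nth_equalityI) auto

lemma map_nth_take: "map ((!) xs) [0..<k] = take k xs" if "length xs \<ge> k"
  using that by (intro nth_equalityI) auto

text \<open>The values of the map are existentially quantified away.\<close>

lemma definable_comp:
  assumes "definable k R" "dmap n k F"
  shows "definable n (\<lambda>xs. R (F xs))"
proof -
  have "definable (n + k) (\<lambda>xs. xs ! (n + i) = F (take n xs) ! i)" if "i < k" for i
  proof -
    have "definable (length ([0..<n] @ [n + i])) (\<lambda>xs. xs ! n = F (take n xs) ! i)"
      using assms(2) that by (auto simp: dmap_def dterm_def)
    from definable_select[OF this, of "n + k"] that show ?thesis
      by (subst definable_cong; auto simp: nth_append map_nth_take)
  qed
  then have "definable (n + k) (\<lambda>xs. (\<forall>i<k. xs ! (n + i) = F (take n xs) ! i) \<and> R (map ((!) xs) [n..<n+k]))"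
    using assms(1) by (intro definable_conj definable_all_less definable_select) auto
  from definable_ex[OF this]
  have "definable n (\<lambda>xs. \<exists>ys. length ys = k \<and> (\<forall>i<k. ys ! i = F xs ! i) \<and> R ys)"
    by (subst definable_cong; auto simp: map_nth_drop cong: conj_cong)
  moreover have "(\<exists>ys. length ys = k \<and> (\<forall>i<k. ys ! i = F xs ! i) \<and> R ys) \<longleftrightarrow> R (F xs)" if "length xs = n" for xs
    using assms(2) that by (metis dmap_def nth_equalityI)
  ultimately show ?thesis
    by (subst definable_cong[where S = "\<lambda>xs. \<exists>ys. length ys = k \<and> (\<forall>i<k. ys ! i = F xs ! i) \<and> R ys"])
      (rule sym, assumption+)
qed

lemma dmap_select: "\<forall>i\<in>set is. i < n \<Longrightarrow> dmap n (length is) (\<lambda>xs. map ((!) xs) is)"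
  unfolding dmap_def
  by (auto intro!: dterm_nth)

lemma dmap_cong: "(\<And>xs. length xs = n \<Longrightarrow> F xs = G xs) \<Longrightarrow> dmap n k F \<longleftrightarrow> dmap n k G"
  unfolding dmap_def by (intro conj_cong all_cong imp_cong refl dterm_cong) auto

lemma dmap_take: "k \<le> n \<Longrightarrow> dmap n k (\<lambda>xs. take k xs)"
  using dmap_select[of "[0..<k]" n] by (subst dmap_cong[where G = "\<lambda>xs. map ((!) xs) [0..<k]"]) (auto simp: map_nth_take)

lemma dmap_drop: "dmap (n + k) k (\<lambda>xs. drop n xs)"
  using dmap_select[of "[n..<n+k]" "n + k"] by (subst dmap_cong[where G = "\<lambda>xs. map ((!) xs) [n..<n+k]"]) (auto simp: map_nth_drop)

lemma dmap_append:
  assumes "dmap n k F" "dmap n l G"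
  shows "dmap n (k + l) (\<lambda>xs. F xs @ G xs)"
  unfolding dmap_def
proof (intro conjI allI impI)
  fix i assume i: "i < k + l"
  show "dterm n (\<lambda>xs. (F xs @ G xs) ! i)"
  proof (cases "i < k")
    case True
    with assms show ?thesis by (subst dterm_cong[where s = "\<lambda>xs. F xs ! i"]) (auto simp: dmap_def nth_append)
  next
    case False
    with assms i show ?thesis by (subst dterm_cong[where s = "\<lambda>xs. G xs ! (i - k)"]) (auto simp: dmap_def nth_append)
  qed
qed (use assms in \<open>auto simp: dmap_def\<close>)

lemma dmap_single: "dterm n t \<Longrightarrow> dmap n (Suc 0) (\<lambda>xs. [t xs])"
  by (auto simp: dmap_def)

lemma dmap_Nil: "dmap n 0 (\<lambda>xs. [])"
  by (auto simp: dmap_def)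

lemma dmap_Cons:
  assumes "dterm n t" "dmap n k G"
  shows "dmap n (Suc k) (\<lambda>xs. t xs # G xs)"
  using dmap_append[OF dmap_single[OF assms(1)] assms(2)] by simp

lemma dmap_pair: "dterm n s \<Longrightarrow> dterm n t \<Longrightarrow> dmap n 2 (\<lambda>xs. [s xs, t xs])"
  unfolding numeral_2_eq_2 by (intro dmap_Cons dmap_Nil)

lemma dterm_take: "dterm n t \<Longrightarrow> n \<le> k \<Longrightarrow> dterm k (\<lambda>xs. t (take n xs))"
  unfolding dterm_def
proof -
  assume "definable (Suc n) (\<lambda>xs. xs ! n = t (take n xs))" "n \<le> k"
  then have "definable (length ([0..<n] @ [k])) (\<lambda>xs. xs ! n = t (take n xs))" by simp
  from definable_select[OF this, of "Suc k"] \<open>n \<le> k\<close>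
  show "definable (Suc k) (\<lambda>xs. xs ! k = t (take n (take k xs)))"
    by (subst definable_cong; auto simp: nth_append map_nth_take min_def)
qed

lemma dterm_comp:
  assumes "dterm k t" "dmap n k F"
  shows "dterm n (\<lambda>xs. t (F xs))"
proof -
  have "dmap (Suc n) k (\<lambda>xs. F (take n xs))"
    using assms(2) by (auto simp: dmap_def intro!: dterm_take[where t = "\<lambda>xs. F xs ! _"])
  from dmap_append[OF this dmap_single[OF dterm_nth, of n]]
  have "dmap (Suc n) (Suc k) (\<lambda>xs. F (take n xs) @ [xs ! n])" by simp
  from definable_comp[OF assms(1)[unfolded dterm_def] this]
  show ?thesis unfolding dterm_def
    using assms(2) by (subst definable_cong; auto simp: dmap_def nth_append)
qed

lemma dmap_comp:
  assumes "dmap k l G" "dmap n k F"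
  shows "dmap n l (\<lambda>xs. G (F xs))"
  using assms dterm_comp[of k "\<lambda>xs. G xs ! _" n F] by (auto simp: dmap_def)

lemma definable2:
  assumes "definable 2 (\<lambda>xs. P (xs ! 0) (xs ! 1))" "dterm n s" "dterm n t"
  shows "definable n (\<lambda>xs. P (s xs) (t xs))"
  using definable_comp[OF assms(1) dmap_pair[OF assms(2,3)]] by simp

lemma definable_eq: "dterm n s \<Longrightarrow> dterm n t \<Longrightarrow> definable n (\<lambda>xs. s xs = t xs)"
  using definable2[of "(=)", OF definable_nth_eq[of 0 2 1]] by simp

lemma definable_le: "dterm n s \<Longrightarrow> dterm n t \<Longrightarrow> definable n (\<lambda>xs. s xs \<le> t xs)"
proof (rule definable2[of "(\<le>)"])
  have "definable (Suc 2) (\<lambda>xs. xs ! 1 = xs ! 0 + xs ! 2)"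
    by (intro definable_nth_add) auto
  from definable_ex1[OF this] show "definable 2 (\<lambda>xs. xs ! 0 \<le> xs ! 1)"
    by (subst definable_cong; auto simp: nth_append le_iff_add)
qed

lemma definable_less: "dterm n s \<Longrightarrow> dterm n t \<Longrightarrow> definable n (\<lambda>xs. s xs < t xs)"
  using definable_not[OF definable_le, of n t s] by (simp add: not_le)

lemma dterm_add: "dterm n s \<Longrightarrow> dterm n t \<Longrightarrow> dterm n (\<lambda>xs. s xs + t xs)"
proof -
  assume "dterm n s" "dterm n t"
  then have "dmap n 2 (\<lambda>xs. [s xs, t xs])"
    by (rule dmap_pair)
  moreover have "dterm 2 (\<lambda>xs. xs ! 0 + xs ! 1)"
    unfolding dterm_def using definable_nth_add[of 2 "Suc 2" 0 1] by simp
  ultimately show ?thesis by (auto dest: dterm_comp)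
qed

text \<open>Zero is the only solution of x = x + x, so all three indices of the addition
  coincide.\<close>

lemma dterm_0: "dterm n (\<lambda>_. 0)"
  unfolding dterm_def using definable_nth_add[of n "Suc n" n n] by simp

text \<open>The signature has no constants; 1 is characterized as the least positive number.\<close>

lemma dterm_1: "dterm n (\<lambda>_. 1)"
proof -
  have "definable (Suc (Suc n)) (\<lambda>xs. 0 < xs ! Suc n \<longrightarrow> xs ! n \<le> xs ! Suc n)"
    by (intro definable_imp definable_le definable_less dterm_0 dterm_nth) auto
  from definable_not[OF definable_ex1[OF definable_not[OF this]]]
  have "definable (Suc n) (\<lambda>xs. \<forall>y. 0 < y \<longrightarrow> xs ! n \<le> y)"
    by (rule definable_congD) (simp add: nth_append, metis neq0_conv)
  moreover have "definable (Suc n) (\<lambda>xs. 0 < xs ! n)"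
    by (intro definable_less dterm_0 dterm_nth) auto
  ultimately have "definable (Suc n) (\<lambda>xs. 0 < xs ! n \<and> (\<forall>y. 0 < y \<longrightarrow> xs ! n \<le> y))"
    by (intro definable_conj)
  moreover have "0 < a \<and> (\<forall>y. 0 < y \<longrightarrow> a \<le> y) \<longleftrightarrow> a = 1" for a :: nat
    by (metis One_nat_def Suc_leI le_antisym zero_less_one)
  ultimately show ?thesis unfolding dterm_def by simp
qed

lemma dterm_const: "dterm n (\<lambda>_. c)"
proof (induction c)
  case (Suc c)
  from dterm_add[OF this dterm_1] show ?case by simp
qed (rule dterm_0)

lemma dterm_mult: "dterm n t \<Longrightarrow> dterm n (\<lambda>xs. c * t xs)"
  by (induction c) (auto intro: dterm_0 dterm_add)

lemma dterm_if:
  assumes "definable n P" "dterm n s" "dterm n t"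
  shows "dterm n (\<lambda>xs. if P xs then s xs else t xs)"
proof -
  have P: "definable (Suc n) (\<lambda>xs. P (take n xs))"
    by (rule definable_comp[OF assms(1) dmap_take]) simp
  have "definable (Suc n) (\<lambda>xs. (P (take n xs) \<longrightarrow> xs ! n = s (take n xs)) \<and> (\<not> P (take n xs) \<longrightarrow> xs ! n = t (take n xs)))"
    using assms by (intro definable_conj definable_imp definable_not P) (auto simp: dterm_def)
  then show ?thesis unfolding dterm_def by (subst definable_cong; auto)
qed

lemma definable_eq_map: 
  assumes "dmap n k F" "dmap n k G"
  shows "definable n (\<lambda>xs. F xs = G xs)"
proof -
  have "definable n (\<lambda>xs. \<forall>i<k. F xs ! i = G xs ! i)"
    using assms by (intro definable_all_less definable_eq) (auto simp: dmap_def)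
  then show ?thesis
    using assms by (subst definable_cong; auto simp: list_eq_iff_nth_eq dmap_def)
qed

lemma definable_exE:
  assumes "definable (n + k) (\<lambda>xs. R (take n xs) (drop n xs))"
  shows "definable n (\<lambda>xs. \<exists>ys. length ys = k \<and> R xs ys)"
  using definable_ex[OF assms] by (subst definable_cong; auto)

lemma dmap_update:
  assumes "dmap n k F" "dterm n t"
  shows "dmap n k (\<lambda>xs. (F xs)[i := t xs])"
  unfolding dmap_def
proof (intro conjI allI impI)
  fix j assume "j < k"
  then show "dterm n (\<lambda>xs. (F xs)[i := t xs] ! j)"
    using assms by (cases "i = j"; subst dterm_cong[where s = "if i = j then t else (\<lambda>xs. F xs ! j)"]) (auto simp: dmap_def)
qed (use assms in \<open>auto simp: dmap_def\<close>)

lemma dmap_id: "dmap n n (\<lambda>xs. xs)"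
  by (auto simp: dmap_def intro: dterm_nth)

section \<open>Definable bijections\<close>

definition tuples :: "nat \<Rightarrow> nat list set" where
  "tuples n = {xs. length xs = n}"

lemma in_tuples_iff [simp]: "xs \<in> tuples n \<longleftrightarrow> length xs = n"
  by (simp add: tuples_def)

text \<open>Only the graph of \<open>f\<close> on \<open>A\<close> has to be definable. This makes
  the notion symmetric, indifferent to the values of \<open>f\<close> outside \<open>A\<close>, and
  strong enough to make both sets definable.\<close>

definition diso :: "nat \<Rightarrow> nat list set \<Rightarrow> nat \<Rightarrow> nat list set \<Rightarrow> bool" where
  "diso a A b B \<longleftrightarrow> A \<subseteq> tuples a \<and> B \<subseteq> tuples b \<and>
     (\<exists>f. bij_betw f A B \<and> definable (a + b) (\<lambda>z. take a z \<in> A \<and> f (take a z) = drop a z))"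

lemma diso_sym:
  assumes "diso a A b B"
  shows "diso b B a A"
proof -
  from assms obtain f where AB: "A \<subseteq> tuples a" "B \<subseteq> tuples b" and f: "bij_betw f A B"
    and R: "definable (a + b) (\<lambda>z. take a z \<in> A \<and> f (take a z) = drop a z)"
    unfolding diso_def by blast
  have "dmap (b + a) (a + b) (\<lambda>z. drop b z @ take b z)"
    by (intro dmap_append dmap_drop dmap_take) simp
  from definable_comp[OF R this]
  have "definable (b + a) (\<lambda>z. take b z \<in> B \<and> inv_into A f (take b z) = drop b z)"
  proof (rule definable_congD)
    fix z :: "nat list" assume "length z = b + a"
    then have z: "take a (drop b z @ take b z) = drop b z" "drop a (drop b z @ take b z) = take b z"
      by auto
    show "(take a (drop b z @ take b z) \<in> A \<and> f (take a (drop b z @ take b z)) = drop a (drop b z @ take b z))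
      \<longleftrightarrow> (take b z \<in> B \<and> inv_into A f (take b z) = drop b z)"
      unfolding z using f by (metis bij_betw_inv_into_left bij_betw_inv_into_right bij_betwE bij_betw_inv_into)
  qed
  then show ?thesis
    unfolding diso_def using AB bij_betw_inv_into[OF f] by blast
qed

lemma diso_trans:
  assumes "diso a A b B" "diso b B c C"
  shows "diso a A c C"
proof -
  from assms obtain f g where AB: "A \<subseteq> tuples a" "B \<subseteq> tuples b" "C \<subseteq> tuples c"
    and f: "bij_betw f A B" and g: "bij_betw g B C"
    and R: "definable (a + b) (\<lambda>z. take a z \<in> A \<and> f (take a z) = drop a z)"
    and S: "definable (b + c) (\<lambda>z. take b z \<in> B \<and> g (take b z) = drop b z)"
    unfolding diso_def by blast
  \<comment> \<open>The last \<open>b\<close> coordinates hold the intermediate point, which is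
    quantified away below.\<close>
  have "dmap (a + c + b) (a + b) (\<lambda>z. take a z @ drop (a + c) z)"
    by (intro dmap_append dmap_drop dmap_take) simp
  note R' = definable_comp[OF R this]
  have "dmap (a + c + b) (b + c) (\<lambda>z. drop (a + c) z @ drop a (take (a + c) z))"
    by (intro dmap_append dmap_drop dmap_comp[OF dmap_drop dmap_take]) simp
  note S' = definable_comp[OF S this]
  have "definable (a + c) (\<lambda>z. take a z \<in> A \<and> (g \<circ> f) (take a z) = drop a z)"
  proof (rule definable_congD[OF definable_ex[OF definable_conj[OF R' S']]])
    fix z :: "nat list" assume z: "length z = a + c"
    have "f x \<in> tuples b" if "x \<in> A" for x
      using that f AB(2) by (auto simp: bij_betw_def)
    moreover have "f x \<in> B" if "x \<in> A" for x
      using that f by (auto simp: bij_betw_def)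
    ultimately show "(\<exists>ys. length ys = b \<and>
        (take a (take a (z @ ys) @ drop (a + c) (z @ ys)) \<in> A \<and>
         f (take a (take a (z @ ys) @ drop (a + c) (z @ ys))) = drop a (take a (z @ ys) @ drop (a + c) (z @ ys))) \<and>
        (take b (drop (a + c) (z @ ys) @ drop a (take (a + c) (z @ ys))) \<in> B \<and>
         g (take b (drop (a + c) (z @ ys) @ drop a (take (a + c) (z @ ys)))) =
           drop b (drop (a + c) (z @ ys) @ drop a (take (a + c) (z @ ys)))))
      \<longleftrightarrow> take a z \<in> A \<and> (g \<circ> f) (take a z) = drop a z"
      using z by (auto cong: conj_cong)
  qed
  then show ?thesis
    unfolding diso_def using AB bij_betw_trans[OF f g] by blast
qed

lemma diso_Un:
  assumes "diso a A b B" "diso a A' b B'" "A \<inter> A' = {}" "B \<inter> B' = {}"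
  shows "diso a (A \<union> A') b (B \<union> B')"
proof -
  from assms obtain f g where AB: "A \<subseteq> tuples a" "B \<subseteq> tuples b" "A' \<subseteq> tuples a" "B' \<subseteq> tuples b"
    and f: "bij_betw f A B" and g: "bij_betw g A' B'"
    and R: "definable (a + b) (\<lambda>z. take a z \<in> A \<and> f (take a z) = drop a z)"
    and S: "definable (a + b) (\<lambda>z. take a z \<in> A' \<and> g (take a z) = drop a z)"
    unfolding diso_def by blast
  let ?h = "\<lambda>x. if x \<in> A then f x else g x"
  have "bij_betw ?h A B"
    using f by (simp cong: bij_betw_cong)
  moreover have "bij_betw ?h A' B'"
    using g assms(3) by (subst bij_betw_cong[where g = g]) auto
  ultimately have "bij_betw ?h (A \<union> A') (B \<union> B')"
    using bij_betw_combine assms(4) by blast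
  moreover have "definable (a + b) (\<lambda>z. take a z \<in> A \<union> A' \<and> ?h (take a z) = drop a z)"
    using assms(3) by (intro definable_congD[OF definable_disj[OF R S]]) auto
  ultimately show ?thesis
    unfolding diso_def using AB by blast
qed

lemma diso_map:
  assumes "A \<subseteq> tuples a" "definable a (\<lambda>x. x \<in> A)" "dmap a b F" "inj_on F A"
  shows "diso a A b (F ` A)"
proof -
  have "definable (a + b) (\<lambda>z. take a z \<in> A \<and> F (take a z) = drop a z)"
    by (intro definable_conj definable_comp[OF assms(2)] definable_eq_map[where k = b] dmap_comp[OF assms(3)]
        dmap_drop dmap_take) simp_all
  moreover have "F ` A \<subseteq> tuples b"
    using assms(1,3) by (auto simp: dmap_def)
  ultimately show ?thesis
    unfolding diso_def using assms(1,4) inj_on_imp_bij_betw by blast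
qed

lemma diso_definable:
  assumes "diso a A b B"
  shows "definable a (\<lambda>x. x \<in> A)"
proof -
  from assms obtain f where AB: "A \<subseteq> tuples a" "B \<subseteq> tuples b" and f: "bij_betw f A B"
    and R: "definable (a + b) (\<lambda>z. take a z \<in> A \<and> f (take a z) = drop a z)"
    unfolding diso_def by blast
  have "f x \<in> tuples b" if "x \<in> A" for x
    using that f AB(2) by (auto simp: bij_betw_def)
  then show ?thesis
    by (intro definable_congD[OF definable_ex[OF R]]) auto
qed

lemma diso_definable': "diso a A b B \<Longrightarrow> definable b (\<lambda>x. x \<in> B)"
  using diso_definable diso_sym by blast

section \<open>Absorption of one power of N by another\<close>

lemma dmap_if:
  assumes "definable n P" "dmap n k F" "dmap n k G"
  shows "dmap n k (\<lambda>xs. if P xs then F xs else G xs)"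
  unfolding dmap_def
proof (intro conjI allI impI)
  fix i assume "i < k"
  with assms have "dterm n (\<lambda>xs. if P xs then F xs ! i else G xs ! i)"
    by (intro dterm_if) (auto simp: dmap_def)
  then show "dterm n (\<lambda>xs. (if P xs then F xs else G xs) ! i)"
    by (simp add: if_distrib[of "\<lambda>xs. xs ! i"])
qed (use assms in \<open>auto simp: dmap_def\<close>)

lemma dmap_const: "dmap n (length ys) (\<lambda>_. ys)"
  by (auto simp: dmap_def intro: dterm_const)

lemma list_update_eq_iff:
  "i < length xs \<Longrightarrow> length ys = length xs \<Longrightarrow>
   xs[i := a] = ys[i := b] \<longleftrightarrow> a = b \<and> (\<forall>j<length xs. j \<noteq> i \<longrightarrow> xs ! j = ys ! j)"
  by (auto simp: list_eq_iff_nth_eq nth_list_update)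

text \<open>An update changes nothing but coordinate \<open>i\<close>, so it suffices to recover the
  old entry there from the new one and the other coordinates. The substitutions of the case
  distinctions all have this shape.\<close>

lemma inj_on_list_update:
  assumes "i < n"
    and "\<And>xs ys. (\<And>j. j < n \<Longrightarrow> j \<noteq> i \<Longrightarrow> xs ! j = ys ! j) \<Longrightarrow> t xs = t ys \<Longrightarrow> xs ! i = ys ! i"
  shows "inj_on (\<lambda>xs. xs[i := t xs]) (tuples n)"
proof (rule inj_onI)
  fix xs ys assume *: "xs \<in> tuples n" "ys \<in> tuples n" "xs[i := t xs] = ys[i := t ys]"
  then have eq: "t xs = t ys" "\<And>j. j < n \<Longrightarrow> j \<noteq> i \<Longrightarrow> xs ! j = ys ! j"
    using assms(1) by (auto simp: list_update_eq_iff)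
  with assms(2)[of xs ys] have "xs ! j = ys ! j" if "j < n" for j
    using that by (cases "j = i") auto
  with * show "xs = ys" by (auto intro: nth_equalityI)
qed

lemma definable_tuples: "definable n (\<lambda>xs. xs \<in> tuples n)"
  by (rule definable_congD[OF definable_const[of n True]]) simp

lemma diso_refl: "A \<subseteq> tuples a \<Longrightarrow> definable a (\<lambda>x. x \<in> A) \<Longrightarrow> diso a A a A"
  using diso_map[OF _ _ dmap_id, of A a] by auto

text \<open>For \<open>j = k\<close> the first coordinate is split by parity; for \<open>j < k\<close> room is made by Hilbert's
  hotel along coordinate \<open>j\<close> of the tuples whose later coordinates vanish.\<close>

lemma tuples_absorb:
  assumes "j \<le> k" "0 < k"
  shows "\<exists>P Q. P \<inter> Q = {} \<and> P \<union> Q = tuples k \<and> diso k (tuples k) k P \<and> diso j (tuples j) k Q"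
proof (cases "j = k")
  case True
  let ?F = "\<lambda>xs :: nat list. xs[0 := 2 * xs ! 0]"
  let ?G = "\<lambda>xs :: nat list. xs[0 := 2 * xs ! 0 + 1]"
  have dm: "dmap k k ?F" "dmap k k ?G"
    using assms(2) by (intro dmap_update dmap_id dterm_add dterm_mult dterm_const dterm_nth; simp)+
  have "inj_on ?F (tuples k)" "inj_on ?G (tuples k)"
    using assms(2) by (intro inj_on_list_update; simp)+
  then have d: "diso k (tuples k) k (?F ` tuples k)" "diso k (tuples k) k (?G ` tuples k)"
    using dm by (auto intro!: diso_map definable_tuples)
  have disj: "?F ` tuples k \<inter> ?G ` tuples k = {}"
    using assms(2) by (auto simp: list_update_eq_iff) presburger
  have cover: "xs \<in> ?F ` tuples k \<union> ?G ` tuples k" if "length xs = k" for xs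
  proof (cases "even (xs ! 0)")
    case True
    then have "xs = ?F (xs[0 := xs ! 0 div 2])" using that assms(2) by simp
    then show ?thesis by (rule UnI1[OF image_eqI]) (simp add: that)
  next
    case False
    then have "xs = ?G (xs[0 := xs ! 0 div 2])" using that assms(2) by simp
    then show ?thesis by (rule UnI2[OF image_eqI]) (simp add: that)
  qed
  have "?F ` tuples k \<union> ?G ` tuples k = tuples k"
  proof
    show "tuples k \<subseteq> ?F ` tuples k \<union> ?G ` tuples k"
      by (rule subsetI, rule cover) simp
  qed auto
  with disj d True show ?thesis by blast
next
  case False
  with assms have jk: "j < k" by simp
  define P :: "nat list \<Rightarrow> bool" where "P xs \<longleftrightarrow> (\<forall>i<k. j < i \<longrightarrow> xs ! i = 0)" for xs
  let ?F = "\<lambda>xs :: nat list. if P xs then xs[j := xs ! j + 1] else xs"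
  let ?G = "\<lambda>xs :: nat list. xs @ replicate (k - j) 0"
  have defP: "definable k P"
    unfolding P_def
    by (intro definable_all_less definable_imp definable_const definable_eq dterm_const dterm_nth)
  then have dmF: "dmap k k ?F"
    using jk by (intro dmap_if dmap_update dmap_id dterm_add dterm_const dterm_nth) simp_all
  have dmG: "dmap j k ?G"
    using dmap_append[OF dmap_id dmap_const[of j "replicate (k - j) 0"]] jk by simp
  have P_upd: "P (xs[j := a]) \<longleftrightarrow> P xs" for xs a
    by (simp add: P_def)
  have F_P: "P (?F xs) \<longleftrightarrow> P xs" for xs
    by (simp add: P_upd)
  have "inj_on ?F (tuples k)"
  proof (rule inj_onI)
    fix xs ys assume *: "xs \<in> tuples k" "ys \<in> tuples k" "?F xs = ?F ys"
    then have P: "P xs \<longleftrightarrow> P ys" using F_P[of xs] F_P[of ys] by metis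
    show "xs = ys"
    proof (cases "P xs")
      case True
      with * P have "xs[j := xs ! j + 1] = ys[j := ys ! j + 1]" by simp
      with * jk have "xs ! j = ys ! j" "\<forall>i<k. i \<noteq> j \<longrightarrow> xs ! i = ys ! i"
        by (simp_all add: list_update_eq_iff)
      then have "xs ! i = ys ! i" if "i < k" for i
        using that by (cases "i = j") simp_all
      with * show ?thesis by (intro nth_equalityI) simp_all
    next
      case False
      with * P show ?thesis by simp
    qed
  qed
  then have d: "diso k (tuples k) k (?F ` tuples k)"
    using dmF by (intro diso_map definable_tuples) auto
  have d': "diso j (tuples j) k (?G ` tuples j)"
    using dmG by (intro diso_map definable_tuples) (auto simp: inj_on_def)
  \<comment> \<open>These are exactly the tuples whose coordinates from \<open>j\<close> on all
    vanish, the room that the shift \<open>?F\<close> vacates.\<close>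
  have G: "?G ` tuples j = {xs. length xs = k \<and> P xs \<and> xs ! j = 0}"
  proof (intro set_eqI iffI)
    fix xs assume "xs \<in> {xs. length xs = k \<and> P xs \<and> xs ! j = 0}"
    then have xs: "length xs = k" "P xs" "xs ! j = 0" by auto
    have "xs = ?G (take j xs)"
    proof (rule nth_equalityI)
      fix i assume i: "i < length xs"
      show "xs ! i = ?G (take j xs) ! i"
        using xs i jk by (cases i j rule: linorder_cases) (auto simp: nth_append P_def)
    qed (use xs jk in simp)
    then show "xs \<in> ?G ` tuples j"
      using xs jk by (intro image_eqI[of _ _ "take j xs"]) auto
  qed (use jk in \<open>auto simp: nth_append P_def\<close>)
  have F: "?F ` tuples k = {xs. length xs = k \<and> \<not> (P xs \<and> xs ! j = 0)}"
  proof (intro set_eqI iffI)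
    fix xs assume "xs \<in> {xs. length xs = k \<and> \<not> (P xs \<and> xs ! j = 0)}"
    then have xs: "length xs = k" "\<not> (P xs \<and> xs ! j = 0)" by auto
    show "xs \<in> ?F ` tuples k"
    proof (cases "P xs")
      case True
      with xs jk have "xs = ?F (xs[j := xs ! j - 1])"
        by (simp add: P_upd)
      then show ?thesis by (rule image_eqI) (simp add: xs(1))
    next
      case False
      then show ?thesis using xs(1) by (intro image_eqI[of _ _ xs]) auto
    qed
  next
    fix xs assume "xs \<in> ?F ` tuples k"
    then show "xs \<in> {xs. length xs = k \<and> \<not> (P xs \<and> xs ! j = 0)}"
      using jk by (auto simp: P_upd)
  qed
  have "?F ` tuples k \<inter> ?G ` tuples j = {}" "?F ` tuples k \<union> ?G ` tuples j = tuples k"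
    unfolding F G by auto
  with d d' show ?thesis by blast
qed

lemma diso_absorb:
  assumes "diso m A k (tuples k)" "diso m B j (tuples j)" "A \<inter> B = {}" "j \<le> k" "0 < k"
  shows "diso m (A \<union> B) k (tuples k)"
proof -
  from tuples_absorb[OF assms(4,5)] obtain P Q where PQ: "P \<inter> Q = {}" "P \<union> Q = tuples k"
    "diso k (tuples k) k P" "diso j (tuples j) k Q" by blast
  from diso_Un[OF diso_trans[OF assms(1) PQ(3)] diso_trans[OF assms(2) PQ(4)] assms(3) PQ(1)] PQ(2)
  show ?thesis by simp
qed

section \<open>Finite disjoint unions of copies of coordinate subspaces\<close>

text \<open>The tuples keep length \<open>m\<close>, with zeros outside \<open>S\<close>, so that
  all pieces lie in one space and the same substitution acts on cubes of every dimension.\<close>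

definition cube :: "nat \<Rightarrow> nat set \<Rightarrow> nat list set" where
  "cube m S = {xs. length xs = m \<and> (\<forall>i<m. i \<notin> S \<longrightarrow> xs ! i = 0)}"

lemma cube_subset: "cube m S \<subseteq> tuples m"
  by (auto simp: cube_def)

lemma definable_cube: "definable m (\<lambda>x. x \<in> cube m S)"
proof -
  have "definable m (\<lambda>xs. \<forall>i<m. i \<notin> S \<longrightarrow> xs ! i = 0)"
    by (intro definable_all_less definable_imp definable_const definable_eq dterm_nth dterm_const)
  then show ?thesis by (rule definable_congD) (simp add: cube_def)
qed

lemma diso_cube_tuples:
  assumes "S \<subseteq> {..<m}"
  shows "diso m (cube m S) (card S) (tuples (card S))"
proof -
  define l where "l = sorted_list_of_set S"
  have S: "finite S" using assms finite_subset by blast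
  then have l: "set l = S" "distinct l" "length l = card S"
    by (auto simp: l_def)
  let ?F = "\<lambda>xs :: nat list. map ((!) xs) l"
  have "dmap m (card S) ?F"
    using dmap_select[of l m] l assms by auto
  moreover have "inj_on ?F (cube m S)"
  proof (rule inj_onI)
    fix xs ys assume *: "xs \<in> cube m S" "ys \<in> cube m S" "?F xs = ?F ys"
    then have "xs ! i = ys ! i" if "i < m" for i
      using that l by (cases "i \<in> S") (auto simp: cube_def)
    with * show "xs = ys"
      by (intro nth_equalityI) (auto simp: cube_def)
  qed
  moreover have "?F ` cube m S = tuples (card S)"
  proof (intro set_eqI iffI)
    fix ys assume ys: "ys \<in> tuples (card S)"
    \<comment> \<open>The preimage of \<open>ys\<close> spreads its entries over the positions in
      \<open>S\<close>, position \<open>l ! k\<close> receiving \<open>ys ! k\<close>.\<close>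
    define xs where "xs = map (\<lambda>i. if i \<in> S then ys ! inv_into {..<card S} ((!) l) i else 0) [0..<m]"
    have inj: "inj_on ((!) l) {..<card S}"
      using l by (auto simp: inj_on_def nth_eq_iff_index_eq)
    have "l ! k < m" "l ! k \<in> S" if "k < card S" for k
      using that l assms by (metis lessThan_iff nth_mem subset_iff, metis nth_mem)
    then have "?F xs = ys"
      using ys l inj by (intro nth_equalityI) (auto simp: xs_def)
    moreover have "xs \<in> cube m S"
      by (auto simp: cube_def xs_def)
    ultimately show "ys \<in> ?F ` cube m S" by blast
  qed (use l in auto)
  ultimately show ?thesis
    using diso_map[OF cube_subset definable_cube] by metis
qed

text \<open>That the bijections found later are affine is forgotten here: the classification uses
  only that the pieces are disjoint and which dimensions their cubes have.\<close>

inductive tame :: "nat \<Rightarrow> nat list set \<Rightarrow> bool" for m where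
  tame_empty: "tame m {}"
| tame_cell: "tame m A \<Longrightarrow> S \<subseteq> {..<m} \<Longrightarrow> diso m (cube m S) m B \<Longrightarrow> A \<inter> B = {} \<Longrightarrow> tame m (A \<union> B)"

lemma tame_Un:
  assumes "tame m A" "tame m B" "A \<inter> B = {}"
  shows "tame m (A \<union> B)"
  using assms(2,3)
proof (induction rule: tame.induct)
  case tame_empty
  then show ?case using assms(1) by simp
next
  case (tame_cell B S C)
  then have "tame m ((A \<union> B) \<union> C)"
    by (intro tame.tame_cell[of m "A \<union> B" S C]) auto
  then show ?case by (simp add: Un_assoc)
qed

lemma tame_UN:
  assumes "finite I" "\<And>i. i \<in> I \<Longrightarrow> tame m (A i)" "\<And>i j. i \<in> I \<Longrightarrow> j \<in> I \<Longrightarrow> i \<noteq> j \<Longrightarrow> A i \<inter> A j = {}"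
  shows "tame m (\<Union>i\<in>I. A i)"
  using assms
proof (induction I rule: finite_induct)
  case (insert i I)
  then have "tame m (A i \<union> (\<Union>i\<in>I. A i))"
    by (intro tame_Un) auto
  then show ?case by simp
qed (simp add: tame_empty)

lemma tame_subset: "tame m A \<Longrightarrow> A \<subseteq> tuples m"
  by (induction rule: tame.induct) (auto simp: diso_def)

text \<open>Injectivity on all tuples, not merely on each piece, keeps the images of disjoint pieces
  disjoint. This carries a decomposition through one substitution.\<close>

lemma tame_image:
  assumes "tame m A" "dmap m m F" "inj_on F (tuples m)"
  shows "tame m (F ` A)"
  using assms(1)
proof (induction rule: tame.induct)
  case (tame_cell A S B)
  then have B: "B \<subseteq> tuples m" by (simp add: diso_def)
  have *: "diso m B m (F ` B)"
    using diso_definable'[OF tame_cell(3)] B assms(2,3) inj_on_subset by (intro diso_map) blast+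
  have "F ` A \<inter> F ` B = {}"
    using inj_on_image_Int[OF assms(3) tame_subset[OF tame_cell(1)] B] tame_cell(4) by simp
  with tame_cell.IH have "tame m (F ` A \<union> F ` B)"
    by (intro tame.tame_cell[OF _ tame_cell(2) diso_trans[OF tame_cell(3) *]])
  then show ?case
    by (simp add: image_Un)
qed (simp add: tame_empty)

lemma tame_cube: "S \<subseteq> {..<m} \<Longrightarrow> tame m (cube m S)"
  using tame_cell[OF tame_empty _ diso_refl[OF cube_subset definable_cube], of S m] by simp

lemma diso_finite: "diso a A b B \<Longrightarrow> finite B \<Longrightarrow> finite A"
  unfolding diso_def by (metis bij_betw_finite)

text \<open>A point is a copy of the zeroth power of N, whose only tuple is
  \<open>[]\<close>.\<close>

lemma diso_singleton:
  assumes "length p = m"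
  shows "diso m {p} 0 (tuples 0)"
proof -
  have "definable m (\<lambda>x. x = p)"
    using dmap_const[of m p] assms by (intro definable_eq_map[where k = m] dmap_id) simp
  then have "diso m {p} 0 ((\<lambda>_. []) ` {p})"
    using assms by (intro diso_map dmap_Nil) auto
  then show ?thesis by (simp add: tuples_def)
qed

text \<open>New points are absorbed one at a time as copies of the zeroth power, which takes room
  and hence \<open>0 < k\<close>. Points already in \<open>B\<close> change nothing.\<close>

lemma diso_insert_finite:
  assumes "finite A" "diso m B k (tuples k)" "0 < k" "A \<subseteq> tuples m"
  shows "diso m (A \<union> B) k (tuples k)"
  using assms(1,4)
proof (induction A rule: finite_induct)
  case (insert p A)
  then have IH: "diso m (A \<union> B) k (tuples k)" by simp
  show ?case
  proof (cases "p \<in> A \<union> B")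
    case True
    then show ?thesis using IH by (simp add: insert_absorb)
  next
    case False
    then have "diso m ((A \<union> B) \<union> {p}) k (tuples k)"
      using IH insert.prems diso_singleton[of p m] assms(3)
      by (intro diso_absorb[of m "A \<union> B" k "{p}" 0]) auto
    then show ?thesis by simp
  qed
qed (use assms in simp)

text \<open>When a piece joins the union of the earlier ones, the larger dimension absorbs the
  smaller, so \<open>k\<close> ends up as the largest dimension. Finite unions are kept apart,
  because a finite set is a power of N only if it is a single point.\<close>

lemma tame_classification:
  assumes "tame m A"
  shows "finite A \<or> (\<exists>k. 0 < k \<and> k \<le> m \<and> diso m A k (tuples k))"
  using assms
proof (induction rule: tame.induct)
  case (tame_cell A S B)
  let ?j = "card S"
  have B: "diso m B ?j (tuples ?j)"
    using diso_trans[OF diso_sym[OF tame_cell(3)] diso_cube_tuples[OF tame_cell(2)]] .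
  have j: "?j \<le> m"
    using card_mono[OF _ tame_cell(2)] by simp
  have A: "A \<subseteq> tuples m"
    using tame_subset[OF tame_cell(1)] .
  have B': "B \<subseteq> tuples m" using B by (simp add: diso_def)
  show ?case
  proof (cases "?j = 0")
    case True
    then have fin: "finite B"
      using diso_finite[OF B] by (simp add: tuples_def)
    from tame_cell.IH show ?thesis
    proof
      assume "\<exists>k>0. k \<le> m \<and> diso m A k (tuples k)"
      then show ?thesis
        using diso_insert_finite[OF fin _ _ B', of A] by (auto simp: Un_commute)
    qed (use fin in simp)
  next
    case False
    from tame_cell.IH show ?thesis
    proof
      assume "finite A"
      then show ?thesis
        using diso_insert_finite[OF _ B _ A] j False by blast
    next
      assume "\<exists>k>0. k \<le> m \<and> diso m A k (tuples k)"
      then obtain k where k: "0 < k" "k \<le> m" "diso m A k (tuples k)" by blast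
      show ?thesis
      proof (cases "?j \<le> k")
        case True
        then show ?thesis using diso_absorb[OF k(3) B tame_cell(4)] k by blast
      next
        case False
        then have "diso m (B \<union> A) ?j (tuples ?j)"
          using tame_cell(4) k by (intro diso_absorb[OF B k(3)]) auto
        with j \<open>?j \<noteq> 0\<close> show ?thesis by (auto simp: Un_commute)
      qed
    qed
  qed
qed simp

section \<open>Splitting definable sets into coordinate subspaces\<close>

definition affine_on :: "nat \<Rightarrow> (nat list \<Rightarrow> int) \<Rightarrow> bool" where
  "affine_on m g \<longleftrightarrow> (\<exists>c a. \<forall>xs. length xs = m \<longrightarrow> g xs = c + (\<Sum>i<m. a i * int (xs ! i)))"

text \<open>Affinity is expressed by pulling affine functions back to affine functions, which is
  equivalent to having affine coordinates and makes closure under composition immediate.\<close>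

definition affine_map :: "nat \<Rightarrow> (nat list \<Rightarrow> nat list) \<Rightarrow> bool" where
  "affine_map m f \<longleftrightarrow> (\<forall>xs. length xs = m \<longrightarrow> length (f xs) = m) \<and>
     (\<forall>g. affine_on m g \<longrightarrow> affine_on m (\<lambda>xs. g (f xs)))"

lemma affine_onI:
  "(\<And>xs. length xs = m \<Longrightarrow> g xs = c + (\<Sum>i<m. a i * int (xs ! i))) \<Longrightarrow> affine_on m g"
  unfolding affine_on_def by blast

lemma affine_on_const: "affine_on m (\<lambda>_. c)"
  by (rule affine_onI[where c = c and a = "\<lambda>_. 0"]) simp

lemma affine_on_nth: "i < m \<Longrightarrow> affine_on m (\<lambda>xs. int (xs ! i))"
  by (rule affine_onI[where c = 0 and a = "\<lambda>j. if j = i then 1 else 0"]) (simp add: if_distrib[of "\<lambda>x. x * _"] sum.delta cong: if_cong)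

lemma affine_on_add: 
  assumes "affine_on m g" "affine_on m h"
  shows "affine_on m (\<lambda>xs. g xs + h xs)"
proof -
  from assms obtain c a c' a' where "\<And>xs. length xs = m \<Longrightarrow> g xs = c + (\<Sum>i<m. a i * int (xs ! i))"
    "\<And>xs. length xs = m \<Longrightarrow> h xs = c' + (\<Sum>i<m. a' i * int (xs ! i))"
    unfolding affine_on_def by metis
  then show ?thesis
    by (intro affine_onI[where c = "c + c'" and a = "\<lambda>i. a i + a' i"])
      (simp add: algebra_simps sum.distrib)
qed

lemma affine_on_mult:
  assumes "affine_on m g"
  shows "affine_on m (\<lambda>xs. k * g xs)"
proof -
  from assms obtain c a where "\<And>xs. length xs = m \<Longrightarrow> g xs = c + (\<Sum>i<m. a i * int (xs ! i))"
    unfolding affine_on_def by metis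
  then show ?thesis
    by (intro affine_onI[where c = "k * c" and a = "\<lambda>i. k * a i"])
      (simp add: algebra_simps sum_distrib_left)
qed

lemma affine_on_int_add:
  "affine_on m (\<lambda>xs. int (s xs)) \<Longrightarrow> affine_on m (\<lambda>xs. int (t xs)) \<Longrightarrow> affine_on m (\<lambda>xs. int (s xs + t xs))"
  unfolding of_nat_add by (rule affine_on_add)

lemma affine_on_int_mult: "affine_on m (\<lambda>xs. int (t xs)) \<Longrightarrow> affine_on m (\<lambda>xs. int (n * t xs))"
  unfolding of_nat_mult by (rule affine_on_mult)

lemma affine_on_sum:
  "(\<And>i. i \<in> I \<Longrightarrow> affine_on m (g i)) \<Longrightarrow> affine_on m (\<lambda>xs. \<Sum>i\<in>I. g i xs)"
  by (induction I rule: infinite_finite_induct) (auto intro: affine_on_const affine_on_add)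

lemma affine_on_cong:
  "affine_on m g \<Longrightarrow> (\<And>xs. length xs = m \<Longrightarrow> g xs = h xs) \<Longrightarrow> affine_on m h"
  unfolding affine_on_def by metis

lemma affine_map_id: "affine_map m (\<lambda>xs. xs)"
  by (simp add: affine_map_def)

lemma affine_map_comp: "affine_map m f \<Longrightarrow> affine_map m g \<Longrightarrow> affine_map m (\<lambda>xs. f (g xs))"
  unfolding affine_map_def by (intro conjI allI impI) (simp, blast)

lemma affine_map_update:
  assumes "i < m" "affine_on m (\<lambda>xs. int (t xs))"
  shows "affine_map m (\<lambda>xs. xs[i := t xs])"
  unfolding affine_map_def
proof (intro conjI allI impI)
  fix g :: "nat list \<Rightarrow> int" assume "affine_on m g"
  then obtain c a where g: "\<And>xs. length xs = m \<Longrightarrow> g xs = c + (\<Sum>j<m. a j * int (xs ! j))"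
    unfolding affine_on_def by blast
  have "affine_on m (\<lambda>xs. int (xs[i := t xs] ! j))" if "j < m" for j
  proof (cases "j = i")
    case True
    then show ?thesis using assms by (intro affine_on_cong[OF assms(2)]) simp
  next
    case False
    then show ?thesis using affine_on_nth[OF that] by simp
  qed
  then have "affine_on m (\<lambda>xs. c + (\<Sum>j<m. a j * int (xs[i := t xs] ! j)))"
    by (intro affine_on_add affine_on_const affine_on_sum affine_on_mult) simp
  then show "affine_on m (\<lambda>xs. g (xs[i := t xs]))"
    by (rule affine_on_cong) (simp add: g)
qed simp

section \<open>Trees of case distinctions\<close>

text \<open>A tree of case distinctions on the tuples of \<open>cube m S\<close>, each branch being parametrized by a
  cube again, after which the predicate is constant on every leaf.\<close>

inductive splits :: "nat \<Rightarrow> nat set \<Rightarrow> (nat list \<Rightarrow> bool) \<Rightarrow> bool" for m where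
  splits_const: "(\<And>xs. xs \<in> cube m S \<Longrightarrow> Q xs \<longleftrightarrow> b) \<Longrightarrow> splits m S Q"
| splits_zero: "i \<in> S \<Longrightarrow> splits m (S - {i}) Q \<Longrightarrow> splits m S (\<lambda>xs. Q (xs[i := xs ! i + 1])) \<Longrightarrow> splits m S Q"
| splits_compare: "i \<in> S \<Longrightarrow> j \<in> S \<Longrightarrow> i \<noteq> j \<Longrightarrow>
    splits m S (\<lambda>xs. Q (xs[i := xs ! i + xs ! j])) \<Longrightarrow>
    splits m S (\<lambda>xs. Q (xs[j := xs ! j + xs ! i + 1])) \<Longrightarrow> splits m S Q"
| splits_residue: "i \<in> S \<Longrightarrow> 0 < n \<Longrightarrow>
    (\<And>r. r < n \<Longrightarrow> splits m S (\<lambda>xs. Q (xs[i := n * xs ! i + r]))) \<Longrightarrow> splits m S Q"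

lemma cube_update: "xs \<in> cube m S \<Longrightarrow> i \<in> S \<Longrightarrow> xs[i := a] \<in> cube m S"
  unfolding cube_def by auto (metis nth_list_update_neq)

lemma cube_remove: "i < m \<Longrightarrow> i \<in> S \<Longrightarrow> xs \<in> cube m (S - {i}) \<longleftrightarrow> xs \<in> cube m S \<and> xs ! i = 0"
  by (auto simp: cube_def)

text \<open>Agreement on the cube is enough, since every substitution maps the cube into itself and
  \<open>cube m (S - {i})\<close> is contained in it.\<close>

lemma splits_cong:
  assumes "splits m S Q" "\<And>xs. xs \<in> cube m S \<Longrightarrow> Q xs \<longleftrightarrow> Q' xs"
  shows "splits m S Q'"
  using assms
proof (induction arbitrary: Q' rule: splits.induct)
  case (splits_const S Q b)
  then show ?case using splits.splits_const[of m S Q' b] by metis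
next
  case (splits_zero i S Q)
  have *: "xs \<in> cube m S" if "xs \<in> cube m (S - {i})" for xs using that by (simp add: cube_def)
  show ?case
  proof (rule splits.splits_zero[OF splits_zero(1)])
    show "splits m (S - {i}) Q'"
      by (rule splits_zero.IH(1)) (intro splits_zero.prems *)
    show "splits m S (\<lambda>xs. Q' (xs[i := xs ! i + 1]))"
      by (rule splits_zero.IH(2)) (intro splits_zero.prems cube_update splits_zero(1))
  qed
next
  case (splits_compare i S j Q)
  show ?case
  proof (rule splits.splits_compare[OF splits_compare(1-3)])
    show "splits m S (\<lambda>xs. Q' (xs[i := xs ! i + xs ! j]))"
      by (rule splits_compare.IH(1)) (intro splits_compare.prems cube_update splits_compare(1))
    show "splits m S (\<lambda>xs. Q' (xs[j := xs ! j + xs ! i + 1]))"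
      by (rule splits_compare.IH(2)) (intro splits_compare.prems cube_update splits_compare(2))
  qed
next
  case (splits_residue i S n Q)
  show ?case
  proof (rule splits.splits_residue[OF splits_residue(1,2)])
    show "splits m S (\<lambda>xs. Q' (xs[i := n * xs ! i + r]))" if "r < n" for r
      by (rule splits_residue.IH[OF that]) (intro splits_residue.prems cube_update splits_residue(1))
  qed
qed

lemma splits_not: "splits m S Q \<Longrightarrow> splits m S (\<lambda>xs. \<not> Q xs)"
proof (induction rule: splits.induct)
  case (splits_const S Q b)
  then show ?case by (intro splits.splits_const[of m S _ "\<not> b"]) auto
next
  case (splits_zero i S Q)
  show ?case by (rule splits.splits_zero[OF splits_zero(1)]) (fact splits_zero.IH)+
next
  case (splits_compare i S j Q)
  show ?case by (rule splits.splits_compare[OF splits_compare(1-3)]) (fact splits_compare.IH)+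
next
  case (splits_residue i S n Q)
  show ?case by (rule splits.splits_residue[OF splits_residue(1,2)]) (rule splits_residue.IH)
qed

text \<open>Substitutions are built in so that a tree can be grafted onto the leaves of another one.\<close>

definition splittable :: "nat \<Rightarrow> (nat list \<Rightarrow> bool) \<Rightarrow> bool" where
  "splittable m Q \<longleftrightarrow> (\<forall>S f. S \<subseteq> {..<m} \<longrightarrow> affine_map m f \<longrightarrow> splits m S (\<lambda>xs. Q (f xs)))"

lemma splittable_affine_map: "splittable m Q \<Longrightarrow> affine_map m f \<Longrightarrow> splittable m (\<lambda>xs. Q (f xs))"
  unfolding splittable_def using affine_map_comp by blast

lemma splittable_not: "splittable m Q \<Longrightarrow> splittable m (\<lambda>xs. \<not> Q xs)"
  unfolding splittable_def using splits_not by blast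

text \<open>The induction follows the tree of \<open>Q\<close> with \<open>R\<close> arbitrary,
  because each branch composes \<open>R\<close> with its substitution. At a leaf where
  \<open>Q\<close> holds, the tree of the resulting \<open>R\<close> is attached; where
  \<open>Q\<close> fails, the conjunction is constantly false.\<close>

lemma splits_conj_splittable:
  assumes "splits m S Q" "S \<subseteq> {..<m}" "splittable m R"
  shows "splits m S (\<lambda>xs. Q xs \<and> R xs)"
  using assms
proof (induction arbitrary: R rule: splits.induct)
  case (splits_const S Q b)
  have R: "splits m S R"
    using splits_const(2,3) affine_map_id unfolding splittable_def by blast
  show ?case
  proof (cases b)
    case True
    then show ?thesis using splits_const(1) by (intro splits_cong[OF R]) auto
  next
    case False
    then show ?thesis using splits_const(1) by (intro splits.splits_const[of m S _ False]) auto
  qed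
next
  case (splits_zero i S Q)
  have "affine_map m (\<lambda>xs. xs[i := xs ! i + 1])"
    using splits_zero(1) splits_zero.prems(1)
    by (intro affine_map_update affine_on_int_add affine_on_nth affine_on_const) auto
  note R = splittable_affine_map[OF splits_zero.prems(2) this]
  have "S - {i} \<subseteq> {..<m}" using splits_zero.prems(1) by blast
  from splits_zero.IH(1)[OF this splits_zero.prems(2)] splits_zero.IH(2)[OF splits_zero.prems(1) R]
  show ?case by (rule splits.splits_zero[OF splits_zero(1)])
next
  case (splits_compare i S j Q)
  then have ij: "i < m" "j < m" by auto
  then have "affine_map m (\<lambda>xs. xs[i := xs ! i + xs ! j])" "affine_map m (\<lambda>xs. xs[j := xs ! j + xs ! i + 1])"
    by (intro affine_map_update affine_on_int_add affine_on_nth affine_on_const; simp)+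
  note R = this[THEN splittable_affine_map[OF splits_compare.prems(2)]]
  from splits_compare.IH(1)[OF splits_compare.prems(1) R(1)] splits_compare.IH(2)[OF splits_compare.prems(1) R(2)]
  show ?case by (rule splits.splits_compare[OF splits_compare(1-3)])
next
  case (splits_residue i S n Q)
  then have "i < m" by auto
  then have "affine_map m (\<lambda>xs. xs[i := n * xs ! i + r])" for r
    by (intro affine_map_update affine_on_int_add affine_on_int_mult affine_on_nth affine_on_const)
  note R = splittable_affine_map[OF splits_residue.prems(2) this]
  from splits_residue.IH[OF _ splits_residue.prems(1) R]
  show ?case by (rule splits.splits_residue[OF splits_residue(1,2)])
qed

lemma splittable_conj:
  assumes "splittable m Q" "splittable m R"
  shows "splittable m (\<lambda>xs. Q xs \<and> R xs)"
  unfolding splittable_def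
proof (intro allI impI)
  fix S f assume S: "S \<subseteq> {..<m}" and f: "affine_map m f"
  with assms(1) have "splits m S (\<lambda>xs. Q (f xs))"
    by (simp add: splittable_def)
  from splits_conj_splittable[OF this S splittable_affine_map[OF assms(2) f]]
  show "splits m S (\<lambda>xs. Q (f xs) \<and> R (f xs))" .
qed

lemma splittable_const: "splittable m (\<lambda>_. P)"
  unfolding splittable_def by (intro allI impI splits_const[where b = P]) simp

lemma splittable_disj: "splittable m Q \<Longrightarrow> splittable m R \<Longrightarrow> splittable m (\<lambda>xs. Q xs \<or> R xs)"
  using splittable_not[OF splittable_conj[OF splittable_not splittable_not], of m Q R] by simp

lemma splittable_imp: "splittable m Q \<Longrightarrow> splittable m R \<Longrightarrow> splittable m (\<lambda>xs. Q xs \<longrightarrow> R xs)"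
  using splittable_not[OF splittable_conj[OF _ splittable_not], of m Q R] by simp

lemma splittable_iff: "splittable m Q \<Longrightarrow> splittable m R \<Longrightarrow> splittable m (\<lambda>xs. Q xs \<longleftrightarrow> R xs)"
  using splittable_conj[OF splittable_imp splittable_imp, of m Q R R Q] by (simp only: iff_conv_conj_imp)

section \<open>Linear inequalities and divisibility conditions\<close>

lemma splits_affineI:
  assumes "affine_on m g" "S \<subseteq> {..<m}"
    and "\<And>c a. splits m S (\<lambda>xs. P (c + (\<Sum>i\<in>S. a i * int (xs ! i))))"
  shows "splits m S (\<lambda>xs. P (g xs))"
proof -
  from assms(1) obtain c a where g: "\<And>xs. length xs = m \<Longrightarrow> g xs = c + (\<Sum>i<m. a i * int (xs ! i))"
    unfolding affine_on_def by blast
  have "c + (\<Sum>i\<in>S. a i * int (xs ! i)) = g xs" if "xs \<in> cube m S" for xs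
  proof -
    \<comment> \<open>Coordinates outside \<open>S\<close> vanish on the cube, so only the
      coefficients in \<open>S\<close> have to be controlled.\<close>
    have "(\<Sum>i\<in>S. a i * int (xs ! i)) = (\<Sum>i<m. a i * int (xs ! i))"
      using assms(2) that by (intro sum.mono_neutral_left) (auto simp: cube_def)
    then show ?thesis using that by (simp add: g cube_def)
  qed
  then show ?thesis
    by (intro splits_cong[OF assms(3)[of c a]]) simp
qed

lemma sum_list_update:
  fixes a :: "nat \<Rightarrow> int"
  assumes "finite S" "i \<in> S" "S \<subseteq> {..<length xs}"
  shows "(\<Sum>j\<in>S. a j * int (xs[i := t] ! j)) = (\<Sum>j\<in>S. a j * int (xs ! j)) + a i * (int t - int (xs ! i))"
proof -
  have "(\<Sum>j\<in>S - {i}. a j * int (xs[i := t] ! j)) = (\<Sum>j\<in>S - {i}. a j * int (xs ! j))"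
    by (intro sum.cong) auto
  moreover have "xs[i := t] ! i = t" using assms by auto
  ultimately show ?thesis
    using assms(1,2) by (simp add: sum.remove[of S i] algebra_simps)
qed

lemma sum_coeff_update:
  fixes a :: "nat \<Rightarrow> int"
  assumes "finite S" "i \<in> S"
  shows "(\<Sum>j\<in>S. (a(i := t)) j * int (xs ! j)) = (\<Sum>j\<in>S. a j * int (xs ! j)) + (t - a i) * int (xs ! i)"
proof -
  have "(\<Sum>j\<in>S - {i}. (a(i := t)) j * int (xs ! j)) = (\<Sum>j\<in>S - {i}. a j * int (xs ! j))"
    by (intro sum.cong) auto
  then show ?thesis
    using assms by (simp add: sum.remove[of S i] algebra_simps)
qed

text \<open>While the constant is negative, a variable with positive coefficient is split: if it is
  zero it leaves \<open>S\<close>, otherwise its coefficient is added to the constant. Either way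
  \<open>nat (- c) + card S\<close> decreases.\<close>

lemma splits_nonneg_coeffs:
  assumes "S \<subseteq> {..<m}" "\<And>i. i \<in> S \<Longrightarrow> (0::int) \<le> a i"
  shows "splits m S (\<lambda>xs. 0 \<le> c + (\<Sum>i\<in>S. a i * int (xs ! i)))"
  using assms
proof (induction "nat (- c) + card S" arbitrary: c S rule: less_induct)
  case less
  let ?g = "\<lambda>S c xs. c + (\<Sum>i\<in>S. a i * int (xs ! i))"
  have fin: "finite S" using less.prems finite_subset by blast
  consider "0 \<le> c" | "c < 0" "\<forall>i\<in>S. a i = 0" | i where "c < 0" "i \<in> S" "0 < a i"
    using less.prems(2) by (metis le_less not_le)
  then show ?case
  proof cases
    case 1
    have "0 \<le> (\<Sum>i\<in>S. a i * int (xs ! i))" for xs :: "nat list"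
      using less.prems(2) by (intro sum_nonneg) simp
    with 1 show ?thesis
      by (intro splits_const[where b = True]) (simp add: add_nonneg_nonneg)
  next
    case 2
    then show ?thesis
      by (intro splits_const[where b = False]) simp
  next
    case 3
    have "card (S - {i}) < card S" using fin 3(2) by (rule card_Diff1_less)
    then have "splits m (S - {i}) (\<lambda>xs. 0 \<le> ?g (S - {i}) c xs)"
      using less.prems by (intro less.hyps) auto
    then have zero: "splits m (S - {i}) (\<lambda>xs. 0 \<le> ?g S c xs)"
    proof (rule splits_cong)
      fix xs assume "xs \<in> cube m (S - {i})"
      then have "xs ! i = 0" using 3 less.prems(1) by (auto simp: cube_def)
      then show "0 \<le> ?g (S - {i}) c xs \<longleftrightarrow> 0 \<le> ?g S c xs"
        using fin 3 by (simp add: sum.remove[of S i])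
    qed
    have "splits m S (\<lambda>xs. 0 \<le> ?g S (c + a i) xs)"
      using less.prems 3 by (intro less.hyps) auto
    then have "splits m S (\<lambda>xs. 0 \<le> ?g S c (xs[i := xs ! i + 1]))"
    proof (rule splits_cong)
      fix xs assume "xs \<in> cube m S"
      then have "S \<subseteq> {..<length xs}" using less.prems(1) by (simp add: cube_def)
      from sum_list_update[OF fin 3(2) this, of a "xs ! i + 1"]
      show "0 \<le> ?g S (c + a i) xs \<longleftrightarrow> 0 \<le> ?g S c (xs[i := xs ! i + 1])"
        by (simp add: algebra_simps)
    qed
    then show ?thesis
      by (rule splits_zero[OF 3(2) zero])
  qed
qed

text \<open>A Euclidean step: if \<open>p\<close> is the largest and \<open>- q\<close> the least coefficient, then distinguishing
  which of the two variables is larger replaces one of the two extreme coefficients by \<open>p - q\<close>.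
  Working with an arbitrary pair of coefficients of opposite sign need not terminate.\<close>

lemma splits_affine_nonneg_bounded:
  fixes p q :: nat
  assumes "S \<subseteq> {..<m}" "\<And>k. k \<in> S \<Longrightarrow> - int q \<le> a k \<and> a k \<le> int p"
  shows "splits m S (\<lambda>xs. 0 \<le> c + (\<Sum>i\<in>S. a i * int (xs ! i)))"
  using assms(2)
proof (induction "(p + q) * Suc (card S) + card {k\<in>S. a k = int p \<or> a k = - int q}" arbitrary: p q c a
    rule: less_induct)
  case less
  let ?g = "\<lambda>c a xs. c + (\<Sum>i\<in>S. a i * int (xs ! i))"
  let ?ext = "\<lambda>p q (a :: nat \<Rightarrow> int). {k\<in>S. a k = int p \<or> a k = - int q}"
  have fin: "finite S" using assms(1) finite_subset by blast
  \<comment> \<open>At most \<open>card S\<close> coefficients are extreme, so the weight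
    \<open>Suc (card S)\<close> lets one unit of \<open>p\<close> or \<open>q\<close> pay for any
    number of newly extreme ones.\<close>
  have shrink: "p' * Suc (card S) + card (?ext p'' q'' a) < r * Suc (card S) + card (?ext p q a)"
    if "Suc p' = r" for p' p'' q'' r
  proof -
    have "card (?ext p'' q'' a) \<le> card S" using fin by (intro card_mono) auto
    then show ?thesis using that by auto
  qed
  have replace: "(p + q) * Suc (card S) + card (?ext p q (a(i := t))) < (p + q) * Suc (card S) + card (?ext p q a)"
    if "i \<in> ?ext p q a" "- int q < t" "t < int p" for i t
  proof -
    have "?ext p q (a(i := t)) \<subset> ?ext p q a" using that by auto
    with fin show ?thesis by (simp add: psubset_card_mono)
  qed
  consider "q = 0" | "p = 0" | "0 < p" "\<forall>k\<in>S. a k \<noteq> int p" | "0 < q" "\<forall>k\<in>S. a k \<noteq> - int q"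
    | i j where "0 < p" "0 < q" "i \<in> S" "a i = int p" "j \<in> S" "a j = - int q"
    by blast
  then show ?case
  proof cases
    case 1
    with less.prems show ?thesis by (intro splits_nonneg_coeffs[OF assms(1)]) simp
  next
    case 2
    \<comment> \<open>An integer z is negative exactly if - 1 - z is nonnegative, so a form without
      positive coefficients is treated through the negated inequality.\<close>
    with less.prems have "splits m S (\<lambda>xs. 0 \<le> (- 1 - c) + (\<Sum>i\<in>S. - a i * int (xs ! i)))"
      by (intro splits_nonneg_coeffs[OF assms(1)]) simp
    from splits_not[OF this] show ?thesis
      by (rule splits_cong) (auto simp: sum_negf)
  next
    case 3
    \<comment> \<open>The bound \<open>p\<close> is not attained and can be lowered.\<close>
    have "Suc (p - 1 + q) = p + q" using 3(1) by simp
    from shrink[OF this] show ?thesis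
    proof (rule less.hyps)
      fix k assume "k \<in> S"
      with less.prems[of k] 3 show "- int q \<le> a k \<and> a k \<le> int (p - 1)" by fastforce
    qed
  next
    case 4
    have "Suc (p + (q - 1)) = p + q" using 4(1) by simp
    from shrink[OF this] show ?thesis
    proof (rule less.hyps)
      fix k assume "k \<in> S"
      with less.prems[of k] 4 show "- int (q - 1) \<le> a k \<and> a k \<le> int p" by fastforce
    qed
  next
    case 5
    then have ij: "i \<noteq> j" by auto
    \<comment> \<open>The new coefficient is \<open>p - q\<close>, strictly between
      \<open>- q\<close> and \<open>p\<close> since both are positive. It replaces an extreme one,
      so the number of extreme coefficients drops.\<close>
    have bounds: "- int q \<le> (a(k := a i + a j)) l \<and> (a(k := a i + a j)) l \<le> int p" if "l \<in> S" for k l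
      using less.prems[OF that] 5 by simp
    have "splits m S (\<lambda>xs. 0 \<le> ?g c (a(j := a i + a j)) xs)"
      by (rule less.hyps[OF replace bounds]) (use 5 in auto)
    then have ge: "splits m S (\<lambda>xs. 0 \<le> ?g c a (xs[i := xs ! i + xs ! j]))"
    proof (rule splits_cong)
      fix xs assume "xs \<in> cube m S"
      then have "S \<subseteq> {..<length xs}" using assms by (simp add: cube_def)
      from sum_list_update[OF fin 5(3) this, of a "xs ! i + xs ! j"]
        sum_coeff_update[OF fin 5(5), of a "a i + a j" xs]
      show "0 \<le> ?g c (a(j := a i + a j)) xs \<longleftrightarrow> 0 \<le> ?g c a (xs[i := xs ! i + xs ! j])"
        by simp
    qed
    \<comment> \<open>The extra \<open>a j\<close> in the constant stems from the 1 in the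
      substitution for \<open>j\<close>, which excludes equality from this branch.\<close>
    have "splits m S (\<lambda>xs. 0 \<le> ?g (c + a j) (a(i := a i + a j)) xs)"
      by (rule less.hyps[OF replace bounds]) (use 5 in auto)
    then have "splits m S (\<lambda>xs. 0 \<le> ?g c a (xs[j := xs ! j + xs ! i + 1]))"
    proof (rule splits_cong)
      fix xs assume "xs \<in> cube m S"
      then have "S \<subseteq> {..<length xs}" using assms by (simp add: cube_def)
      from sum_list_update[OF fin 5(5) this, of a "xs ! j + xs ! i + 1"]
        sum_coeff_update[OF fin 5(3), of a "a i + a j" xs]
      show "0 \<le> ?g (c + a j) (a(i := a i + a j)) xs \<longleftrightarrow> 0 \<le> ?g c a (xs[j := xs ! j + xs ! i + 1])"
        by (simp add: algebra_simps)
    qed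
    then show ?thesis
      by (rule splits_compare[where Q = "\<lambda>xs. 0 \<le> ?g c a xs", OF 5(3,5) ij ge])
  qed
qed

lemma splits_affine_nonneg:
  assumes "S \<subseteq> {..<m}"
  shows "splits m S (\<lambda>xs. 0 \<le> c + (\<Sum>i\<in>S. a i * int (xs ! i)))"
proof -
  have fin: "finite S" using assms finite_subset by blast
  have "\<bar>a k\<bar> \<le> int (nat (\<Sum>k\<in>S. \<bar>a k\<bar>))" if "k \<in> S" for k
    using member_le_sum[OF that _ fin, of "\<lambda>k. \<bar>a k\<bar>"] by simp
  then show ?thesis
    by (intro splits_affine_nonneg_bounded[OF assms, of "nat (\<Sum>k\<in>S. \<bar>a k\<bar>)" _ "nat (\<Sum>k\<in>S. \<bar>a k\<bar>)"])
      (metis abs_le_iff minus_le_iff)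
qed

text \<open>Substituting \<open>n * x + r\<close> for a variable x, with \<open>n\<close> the
  absolute value of \<open>d\<close>, makes its coefficient divisible by \<open>d\<close> and moves
  the residue into the constant. Once all coefficients are divisible, only the constant
  decides.\<close>

lemma splits_dvd:
  assumes "S \<subseteq> {..<m}" "d \<noteq> 0"
  shows "splits m S (\<lambda>xs. d dvd c + (\<Sum>i\<in>S. a i * int (xs ! i)))"
proof (induction "card {i\<in>S. \<not> d dvd a i}" arbitrary: c a rule: less_induct)
  case less
  let ?g = "\<lambda>c a xs. c + (\<Sum>i\<in>S. a i * int (xs ! i))"
  have fin: "finite S" using assms finite_subset by blast
  show ?case
  proof (cases "\<forall>i\<in>S. d dvd a i")
    case True
    then have "d dvd (\<Sum>i\<in>S. a i * int (xs ! i))" for xs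
      by (intro dvd_sum) simp
    then show ?thesis
      by (intro splits_const[where b = "d dvd c"]) (simp add: dvd_add_left_iff)
  next
    case False
    then obtain i where i: "i \<in> S" "\<not> d dvd a i" by blast
    let ?n = "nat \<bar>d\<bar>"
    have "{k\<in>S. \<not> d dvd (a(i := a i * int ?n)) k} \<subset> {k\<in>S. \<not> d dvd a k}"
      using i by auto
    with fin have "card {k\<in>S. \<not> d dvd (a(i := a i * int ?n)) k} < card {k\<in>S. \<not> d dvd a k}"
      by (intro psubset_card_mono) auto
    note IH = less[OF this]
    show ?thesis
    proof (rule splits_residue[of i S ?n])
      fix r
      from IH[of "c + a i * int r"] show "splits m S (\<lambda>xs. d dvd ?g c a (xs[i := ?n * xs ! i + r]))"
      proof (rule splits_cong)
        fix xs assume "xs \<in> cube m S"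
        then have "S \<subseteq> {..<length xs}" using assms by (simp add: cube_def)
        from sum_list_update[OF fin i(1) this, of a "?n * xs ! i + r"]
          sum_coeff_update[OF fin i(1), of a "a i * int ?n" xs]
        have "?g (c + a i * int r) (a(i := a i * int ?n)) xs = ?g c a (xs[i := ?n * xs ! i + r])"
          by (simp add: algebra_simps)
        then show "d dvd ?g (c + a i * int r) (a(i := a i * int ?n)) xs \<longleftrightarrow> d dvd ?g c a (xs[i := ?n * xs ! i + r])"
          by (simp only:)
      qed
    qed (use i assms in auto)
  qed
qed

lemma splittable_affineI:
  assumes "affine_on m g"
    and "\<And>S c a. S \<subseteq> {..<m} \<Longrightarrow> splits m S (\<lambda>xs. P (c + (\<Sum>i\<in>S. a i * int (xs ! i))))"
  shows "splittable m (\<lambda>xs. P (g xs))"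
  unfolding splittable_def
proof (intro allI impI)
  fix S f assume S: "S \<subseteq> {..<m}" and "affine_map m f"
  with assms(1) have "affine_on m (\<lambda>xs. g (f xs))"
    by (simp add: affine_map_def)
  from splits_affineI[OF this S assms(2)[OF S]] show "splits m S (\<lambda>xs. P (g (f xs)))" .
qed

lemma splittable_nonneg: "affine_on m g \<Longrightarrow> splittable m (\<lambda>xs. 0 \<le> g xs)"
  by (rule splittable_affineI[where P = "\<lambda>z. 0 \<le> z", OF _ splits_affine_nonneg])

lemma affine_on_diff: "affine_on m g \<Longrightarrow> affine_on m h \<Longrightarrow> affine_on m (\<lambda>xs. g xs - h xs)"
  using affine_on_add[OF _ affine_on_mult[of m h "-1"], of g] by simp

lemma splittable_le: "affine_on m g \<Longrightarrow> affine_on m h \<Longrightarrow> splittable m (\<lambda>xs. g xs \<le> h xs)"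
  using splittable_nonneg[OF affine_on_diff, of m h g] by simp

lemma splittable_less: "affine_on m g \<Longrightarrow> affine_on m h \<Longrightarrow> splittable m (\<lambda>xs. g xs < h xs)"
  using splittable_not[OF splittable_le, of m h g] by (simp add: not_le)

lemma splittable_eq: "affine_on m g \<Longrightarrow> affine_on m h \<Longrightarrow> splittable m (\<lambda>xs. g xs = h xs)"
  using splittable_conj[OF splittable_le splittable_le, of m g h h g] by (simp add: order_eq_iff)

lemma splittable_dvd:
  assumes "affine_on m g"
  shows "splittable m (\<lambda>xs. d dvd g xs)"
proof (cases "d = 0")
  case True
  then show ?thesis using splittable_eq[OF assms affine_on_const[of m 0]] by simp
next
  case False
  show ?thesis
    by (rule splittable_affineI[where P = "\<lambda>z. d dvd z", OF assms splits_dvd[OF _ False]])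
qed

section \<open>Quantifier elimination\<close>

lemma affine_on_Inum: "affine_on m (\<lambda>xs. Inum (map int xs) t)"
proof -
  have nth: "affine_on m (\<lambda>xs. map int xs ! n)" for n
  proof (cases "n < m")
    case True
    show ?thesis by (rule affine_on_cong[OF affine_on_nth[OF True]]) (simp add: True)
  next
    case False
    \<comment> \<open>An index beyond the list yields an unspecified value, but one that depends on
      \<open>n - m\<close> alone and is therefore constant on lists of length
      \<open>m\<close>.\<close>
    then have "[] ! (n - m) = map int xs ! n" if "length xs = m" for xs
      using that nth_append[of "map int xs" "[]" n] by simp
    then show ?thesis by (rule affine_on_cong[OF affine_on_const])
  qed
  show ?thesis
  proof (induction t)
    case (Neg t)
    then show ?case using affine_on_mult[of m _ "- 1"] by simp
  qed (simp_all add: nth affine_on_const affine_on_add affine_on_mult affine_on_diff)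
qed

lemma splittable_qfree:
  "qfree p \<Longrightarrow> splittable m (\<lambda>xs. Ifm [] (map int xs) p)"
proof (induction p)
  \<comment> \<open>Closed atoms are looked up in the propositional environment, here
    \<open>[]\<close>, so their truth value does not depend on \<open>xs\<close>.\<close>
  case (Closed n)
  then show ?case by (simp add: splittable_const)
next
  case (NClosed n)
  then show ?case by (simp add: splittable_const)
qed (auto intro!: splittable_const splittable_not splittable_conj splittable_disj splittable_imp splittable_iff
    splittable_le splittable_less splittable_eq splittable_dvd affine_on_Inum affine_on_const)

lemma nat_plus_simps [simp]:
  "carrier nat_plus = UNIV" "fun_interp nat_plus f xs = xs ! 0 + xs ! 1"
  by (simp_all add: nat_plus_def)

text \<open>Cooper's formulas speak of integers and use de Bruijn indices. \<open>\<sigma>\<close>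
  gives the position of each named variable in the environment; agreement is asked only for
  variables that occur, as the environment is a finite list.\<close>

lemma tm_translation_exists:
  "tm_of plus_sig s \<Longrightarrow>
   \<exists>t. \<forall>bs e. (\<forall>v\<in>tm_vars s. bs ! \<sigma> v = int (e v)) \<longrightarrow> Inum bs t = int (tm_val nat_plus e s)"
proof (induction s)
  case (Var i)
  then show ?case by (intro exI[of _ "Bound (\<sigma> i)"]) simp
next
  case (App f ts)
  then have "length ts = 2" by (simp add: plus_sig_def)
  then obtain s1 s2 where ts: "ts = [s1, s2]"
    by (auto simp: numeral_2_eq_2 length_Suc_conv)
  with App.prems have "tm_of plus_sig s1" "tm_of plus_sig s2" by auto
  with App.IH[of s1] App.IH[of s2] ts obtain t1 t2 where
    t1: "\<And>bs e. \<forall>v\<in>tm_vars s1. bs ! \<sigma> v = int (e v) \<Longrightarrow> Inum bs t1 = int (tm_val nat_plus e s1)" and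
    t2: "\<And>bs e. \<forall>v\<in>tm_vars s2. bs ! \<sigma> v = int (e v) \<Longrightarrow> Inum bs t2 = int (tm_val nat_plus e s2)"
    by auto
  have "Inum bs (Add t1 t2) = int (tm_val nat_plus e (App f ts))"
    if "\<forall>v\<in>tm_vars (App f ts). bs ! \<sigma> v = int (e v)" for bs e
    using that t1[of bs e] t2[of bs e] by (simp add: ts ball_Un)
  then show ?case by blast
qed

lemma fm_translation_exists:
  "fm_of plus_sig \<phi> \<Longrightarrow>
   \<exists>p. \<forall>bs e. (\<forall>v\<in>free_vars \<phi>. bs ! \<sigma> v = int (e v)) \<longrightarrow> (Ifm [] bs p \<longleftrightarrow> sat nat_plus e \<phi>)"
proof (induction \<phi> arbitrary: \<sigma>)
  case Top
  then show ?case by (intro exI[of _ "Cooper.T"]) simp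
next
  case (Eq s t)
  then have "tm_of plus_sig s" "tm_of plus_sig t" by simp_all
  from this[THEN tm_translation_exists[where \<sigma> = \<sigma>]] obtain s' t' where
    s': "\<And>bs e. \<forall>v\<in>tm_vars s. bs ! \<sigma> v = int (e v) \<Longrightarrow> Inum bs s' = int (tm_val nat_plus e s)" and
    t': "\<And>bs e. \<forall>v\<in>tm_vars t. bs ! \<sigma> v = int (e v) \<Longrightarrow> Inum bs t' = int (tm_val nat_plus e t)"
    by blast
  have "Ifm [] bs (Cooper.fm.Eq (Sub s' t')) \<longleftrightarrow> sat nat_plus e (Eq s t)"
    if "\<forall>v\<in>free_vars (Eq s t). bs ! \<sigma> v = int (e v)" for bs e
    using that s'[of bs e] t'[of bs e] by (simp add: ball_Un)
  then show ?case by blast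
next
  case (Rel p ts)
  then show ?case by (simp add: plus_sig_def)
next
  case (Neg \<phi>)
  from Neg.prems have "fm_of plus_sig \<phi>" by simp
  from Neg.IH[OF this, of \<sigma>] obtain p where
    p: "\<And>bs e. \<forall>v\<in>free_vars \<phi>. bs ! \<sigma> v = int (e v) \<Longrightarrow> Ifm [] bs p \<longleftrightarrow> sat nat_plus e \<phi>"
    by blast
  have "Ifm [] bs (Cooper.Not p) \<longleftrightarrow> sat nat_plus e (Neg \<phi>)"
    if "\<forall>v\<in>free_vars (Neg \<phi>). bs ! \<sigma> v = int (e v)" for bs e
    using that p[of bs e] by simp
  then show ?case by blast
next
  case (Conj \<phi> \<psi>)
  then have "fm_of plus_sig \<phi>" "fm_of plus_sig \<psi>" by simp_all
  from Conj.IH(1)[OF this(1), of \<sigma>] Conj.IH(2)[OF this(2), of \<sigma>] obtain p q where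
    p: "\<And>bs e. \<forall>v\<in>free_vars \<phi>. bs ! \<sigma> v = int (e v) \<Longrightarrow> Ifm [] bs p \<longleftrightarrow> sat nat_plus e \<phi>" and
    q: "\<And>bs e. \<forall>v\<in>free_vars \<psi>. bs ! \<sigma> v = int (e v) \<Longrightarrow> Ifm [] bs q \<longleftrightarrow> sat nat_plus e \<psi>"
    by blast
  have "Ifm [] bs (Cooper.And p q) \<longleftrightarrow> sat nat_plus e (Conj \<phi> \<psi>)"
    if "\<forall>v\<in>free_vars (Conj \<phi> \<psi>). bs ! \<sigma> v = int (e v)" for bs e
    using that p[of bs e] q[of bs e] by (simp add: ball_Un)
  then show ?case by blast
next
  case (Exists i \<phi>)
  \<comment> \<open>Cooper's quantifier puts its witness in front of the environment: the bound
    variable gets position 0 and all others move up by one. Hence \<open>\<sigma>\<close> is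
    arbitrary in the induction.\<close>
  let ?\<sigma> = "\<lambda>v. if v = i then 0 else Suc (\<sigma> v)"
  have "fm_of plus_sig \<phi>" using Exists.prems by simp
  from Exists.IH[OF this, of ?\<sigma>] obtain p where
    p: "\<And>bs e. (\<forall>v\<in>free_vars \<phi>. bs ! ?\<sigma> v = int (e v)) \<Longrightarrow> Ifm [] bs p \<longleftrightarrow> sat nat_plus e \<phi>"
    by blast
  \<comment> \<open>\<open>Ge (Bound 0)\<close> confines the integer quantifier to the natural
    numbers.\<close>
  have "Ifm [] bs (Cooper.E (Cooper.And (Cooper.Ge (Bound 0)) p)) \<longleftrightarrow> sat nat_plus e (Exists i \<phi>)"
    if bs: "\<forall>v\<in>free_vars (Exists i \<phi>). bs ! \<sigma> v = int (e v)" for bs e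
  proof -
    have "Ifm [] (int n # bs) p \<longleftrightarrow> sat nat_plus (e(i := n)) \<phi>" for n
      by (rule p) (use bs in auto)
    moreover have "(\<exists>x\<ge>0. Ifm [] (x # bs) p) \<longleftrightarrow> (\<exists>n. Ifm [] (int n # bs) p)"
      by (metis nat_0_le of_nat_0_le_iff)
    ultimately show ?thesis by simp
  qed
  then show ?case by blast
qed

lemma splits_definable:
  assumes "definable m R"
  shows "splits m {..<m} R"
proof -
  from assms obtain \<phi> where \<phi>: "fm_of plus_sig \<phi>" "free_vars \<phi> \<subseteq> {..<m}"
    "\<And>xs. length xs = m \<Longrightarrow> holds \<phi> xs \<longleftrightarrow> R xs"
    unfolding definable_def plus_fm_in_def by blast
  from fm_translation_exists[OF \<phi>(1), of id] obtain p where
    p: "\<And>bs e. (\<forall>v\<in>free_vars \<phi>. bs ! v = int (e v)) \<Longrightarrow> Ifm [] bs p \<longleftrightarrow> sat nat_plus e \<phi>"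
    by auto
  have "splits m {..<m} (\<lambda>xs. Ifm [] (map int xs) (pa p))"
    using splittable_qfree[of "pa p" m] mirqe affine_map_id[of m] unfolding splittable_def by blast
  then show ?thesis
  proof (rule splits_cong)
    fix xs assume "xs \<in> cube m {..<m}"
    then have len: "length xs = m" by (simp add: cube_def)
    have "Ifm [] (map int xs) p \<longleftrightarrow> holds \<phi> xs"
      unfolding holds_def by (rule p) (use \<phi>(2) len in auto)
    then show "Ifm [] (map int xs) (pa p) \<longleftrightarrow> R xs"
      using mirqe \<phi>(3)[OF len] by blast
  qed
qed

text \<open>At every node the branches parametrize disjoint parts that together cover the cube, and
  the substitutions are injective on \<open>tuples m\<close>; so decompositions are carried from the
  leaves to the root.\<close>

lemma tame_splits:
  assumes "splits m S Q" "S \<subseteq> {..<m}"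
  shows "tame m {xs \<in> cube m S. Q xs}"
  using assms
proof (induction rule: splits.induct)
  case (splits_const S Q b)
  then have "{xs \<in> cube m S. Q xs} = (if b then cube m S else {})" by auto
  then show ?case using tame_cube splits_const(2) tame_empty by auto
next
  case (splits_zero i S Q)
  let ?f = "\<lambda>xs :: nat list. xs[i := xs ! i + 1]"
  let ?D = "{xs \<in> cube m S. Q (?f xs)}"
  from splits_zero have i: "i < m" "i \<in> S" by auto
  have f: "dmap m m ?f" "inj_on ?f (tuples m)"
    using i by (intro dmap_update dmap_id dterm_add dterm_nth dterm_const inj_on_list_update; simp)+
  have "tame m ({xs \<in> cube m (S - {i}). Q xs} \<union> ?f ` ?D)"
  proof (rule tame_Un)
    show "tame m {xs \<in> cube m (S - {i}). Q xs}"
      using splits_zero.IH(1) splits_zero.prems by blast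
    show "tame m (?f ` ?D)"
      by (rule tame_image[OF splits_zero.IH(2)[OF splits_zero.prems] f])
    have "?f xs ! i \<noteq> 0" if "xs \<in> ?D" for xs
      using that i by (simp add: cube_def)
    then show "{xs \<in> cube m (S - {i}). Q xs} \<inter> ?f ` ?D = {}"
      using i by (auto simp only: cube_remove)
  qed
  also have "{xs \<in> cube m (S - {i}). Q xs} \<union> ?f ` ?D = {xs \<in> cube m S. Q xs}" (is "?L = ?R")
  proof
    show "?L \<subseteq> ?R" using cube_remove[OF i] cube_update[OF _ i(2)] by blast
    show "?R \<subseteq> ?L"
    proof
      fix xs assume xs: "xs \<in> ?R"
      show "xs \<in> ?L"
      proof (cases "xs ! i")
        case 0
        then show ?thesis using xs i by (simp add: cube_remove)
      next
        case (Suc n)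
        then have eq: "?f (xs[i := n]) = xs" using xs i by (simp add: cube_def list_update_same_conv)
        have "xs[i := n] \<in> ?D" using xs cube_update[OF _ i(2), of xs m n] unfolding mem_Collect_eq eq by blast
        from imageI[OF this, of ?f] show ?thesis unfolding eq by blast
      qed
    qed
  qed
  finally show ?case .
next
  case (splits_compare i S j Q)
  let ?f = "\<lambda>xs :: nat list. xs[i := xs ! i + xs ! j]"
  let ?g = "\<lambda>xs :: nat list. xs[j := xs ! j + xs ! i + 1]"
  let ?D = "{xs \<in> cube m S. Q (?f xs)}"
  let ?E = "{xs \<in> cube m S. Q (?g xs)}"
  from splits_compare have ij: "i < m" "i \<in> S" "j < m" "j \<in> S" "i \<noteq> j" by auto
  have f: "dmap m m ?f" "inj_on ?f (tuples m)" and g: "dmap m m ?g" "inj_on ?g (tuples m)"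
    using ij by (intro dmap_update dmap_id dterm_add dterm_nth dterm_const inj_on_list_update; simp)+
  have "tame m (?f ` ?D \<union> ?g ` ?E)"
  proof (rule tame_Un)
    show "?f ` ?D \<inter> ?g ` ?E = {}"
    proof -
      \<comment> \<open>In the image of \<open>?f\<close> coordinate \<open>i\<close> is at least
        coordinate \<open>j\<close>; in that of \<open>?g\<close> it is smaller.\<close>
      have "?f xs \<noteq> ?g ys" if "length xs = m" "length ys = m" for xs ys
      proof
        assume "?f xs = ?g ys"
        then have "?f xs ! i = ?g ys ! i" "?f xs ! j = ?g ys ! j" by simp_all
        then show False using ij that by simp
      qed
      then show ?thesis by (auto simp: cube_def)
    qed
    show "tame m (?f ` ?D)"
      by (rule tame_image[OF splits_compare.IH(1)[OF splits_compare.prems] f])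
    show "tame m (?g ` ?E)"
      by (rule tame_image[OF splits_compare.IH(2)[OF splits_compare.prems] g])
  qed
  also have "?f ` ?D \<union> ?g ` ?E = {xs \<in> cube m S. Q xs}" (is "?L = ?R")
  proof
    show "?L \<subseteq> ?R" using cube_update[OF _ ij(2)] cube_update[OF _ ij(4)] by blast
    show "?R \<subseteq> ?L"
    proof
      fix xs assume xs: "xs \<in> ?R"
      then have len: "length xs = m" by (simp add: cube_def)
      show "xs \<in> ?L"
      proof (cases "xs ! j \<le> xs ! i")
        case True
        then have eq: "?f (xs[i := xs ! i - xs ! j]) = xs" using len ij by simp
        have "xs[i := xs ! i - xs ! j] \<in> ?D"
          using xs cube_update[OF _ ij(2), of xs m] unfolding mem_Collect_eq eq by blast
        from imageI[OF this, of ?f] show ?thesis unfolding eq by blast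
      next
        case False
        \<comment> \<open>Coordinate \<open>j\<close> exceeds coordinate \<open>i\<close> here, so
          neither subtraction truncates.\<close>
        then have eq: "?g (xs[j := xs ! j - xs ! i - 1]) = xs" using len ij by simp
        have "xs[j := xs ! j - xs ! i - 1] \<in> ?E"
          using xs cube_update[OF _ ij(4), of xs m] unfolding mem_Collect_eq eq by blast
        from imageI[OF this, of ?g] show ?thesis unfolding eq by blast
      qed
    qed
  qed
  finally show ?case .
next
  case (splits_residue i S n Q)
  let ?f = "\<lambda>r (xs :: nat list). xs[i := n * xs ! i + r]"
  let ?D = "\<lambda>r. {xs \<in> cube m S. Q (?f r xs)}"
  from splits_residue have i: "i < m" "i \<in> S" by auto
  have f: "dmap m m (?f r)" "inj_on (?f r) (tuples m)" for r
    using i splits_residue(2)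
    by (intro dmap_update dmap_id dterm_add dterm_mult dterm_nth dterm_const inj_on_list_update; simp)+
  have "tame m (\<Union>r\<in>{..<n}. ?f r ` ?D r)"
  proof (rule tame_UN)
    fix r s assume "r \<in> {..<n}" "s \<in> {..<n}" "r \<noteq> s"
    \<comment> \<open>The branches are told apart by the remainder of coordinate \<open>i\<close>
      modulo \<open>n\<close>.\<close>
    have "?f r xs \<noteq> ?f s ys" if "length xs = m" "length ys = m" for xs ys
    proof
      assume "?f r xs = ?f s ys"
      then have "?f r xs ! i mod n = ?f s ys ! i mod n" by simp
      then show False
        using i that \<open>r \<in> {..<n}\<close> \<open>s \<in> {..<n}\<close> \<open>r \<noteq> s\<close> by simp
    qed
    then show "?f r ` ?D r \<inter> ?f s ` ?D s = {}" by (auto simp: cube_def)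
  next
    show "tame m (?f r ` ?D r)" if "r \<in> {..<n}" for r
      using that by (intro tame_image[OF splits_residue.IH[OF _ splits_residue.prems] f]) simp
  qed simp
  also have "(\<Union>r\<in>{..<n}. ?f r ` ?D r) = {xs \<in> cube m S. Q xs}" (is "?L = ?R")
  proof
    show "?L \<subseteq> ?R" using cube_update[OF _ i(2)] by blast
    show "?R \<subseteq> ?L"
    proof
      fix xs assume xs: "xs \<in> ?R"
      then have eq: "?f (xs ! i mod n) (xs[i := xs ! i div n]) = xs" using i by (simp add: cube_def)
      have "xs[i := xs ! i div n] \<in> ?D (xs ! i mod n)"
        using xs cube_update[OF _ i(2), of xs m] unfolding mem_Collect_eq eq by blast
      from imageI[OF this, of "?f (xs ! i mod n)"] have "xs \<in> ?f (xs ! i mod n) ` ?D (xs ! i mod n)"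
        unfolding eq .
      then show "xs \<in> ?L" by (rule UN_I[rotated]) (simp add: splits_residue(2))
    qed
  qed
  finally show ?case .
qed

lemma tame_definable:
  assumes "definable m (\<lambda>xs. xs \<in> D)" "D \<subseteq> tuples m"
  shows "tame m D"
proof -
  have "{xs \<in> cube m {..<m}. xs \<in> D} = D" using assms(2) by (auto simp: cube_def)
  with tame_splits[OF splits_definable[OF assms(1)]] show ?thesis by simp
qed

section \<open>Transporting the interpretation\<close>

lemma dmap_take_drop: "i + k \<le> n \<Longrightarrow> dmap n k (\<lambda>xs. take k (drop i xs))"
  using dmap_comp[OF dmap_take[of k "n - i"], of n "drop i"] dmap_drop[of i "n - i"] by simp

text \<open>\<open>lex\<close> relates only lists of equal length and is decided at their first
  difference, for which there are just \<open>m\<close> positions.\<close>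

lemma definable_lex:
  assumes "dmap n m F" "dmap n m G"
  shows "definable n (\<lambda>xs. (F xs, G xs) \<in> lex less_than)"
proof -
  have F: "dmap n i (\<lambda>xs. take i (F xs))" and G: "dmap n i (\<lambda>xs. take i (G xs))" if "i < m" for i
    using that assms dmap_comp[OF dmap_take[of i m]] by simp_all
  have "definable n (\<lambda>xs. \<not> (\<forall>i<m. \<not> (take i (F xs) = take i (G xs) \<and> F xs ! i < G xs ! i)))"
    using assms by (intro definable_not definable_all_less definable_conj definable_eq_map[OF F G] definable_less)
      (simp_all add: dmap_def)
  then show ?thesis
    by (rule definable_congD) (use assms in \<open>auto simp: lexord_lex lexord_take_index_conv dmap_def\<close>)
qed

text \<open>The lexicographically least elements of the classes.\<close>

lemma definable_representatives:
  assumes D: "D \<subseteq> tuples m" "definable m (\<lambda>x. x \<in> D)"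
    and E: "equiv D E" "definable (m + m) (\<lambda>z. (take m z, drop m z) \<in> E)"
  obtains D' where "D' \<subseteq> D" "definable m (\<lambda>x. x \<in> D')" "bij_betw (\<lambda>b. E `` {b}) D' (D // E)"
proof
  let ?less = "lex less_than :: (nat list \<times> nat list) set"
  let ?D' = "{b \<in> D. \<not> (\<exists>c. length c = m \<and> (b, c) \<in> E \<and> (c, b) \<in> ?less)}"
  show "?D' \<subseteq> D" by blast
  have "definable (m + m) (\<lambda>z. (take m z, drop m z) \<in> E \<and> (drop m z, take m z) \<in> ?less)"
    by (intro definable_conj E(2) definable_lex[where m = m] dmap_take dmap_drop) simp
  from definable_conj[OF D(2) definable_not[OF definable_exE[OF this]]]
  show "definable m (\<lambda>x. x \<in> ?D')" by simp
  have E_D: "b \<in> D" "c \<in> D" if "(b, c) \<in> E" for b c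
    using that E(1) by (auto simp: equiv_def refl_on_def)
  show "bij_betw (\<lambda>b. E `` {b}) ?D' (D // E)"
    unfolding bij_betw_def
  proof (intro conjI inj_onI set_eqI iffI)
    fix b c assume b: "b \<in> ?D'" and c: "c \<in> ?D'" and "E `` {b} = E `` {c}"
    then have bc: "(b, c) \<in> E" "(c, b) \<in> E"
      using eq_equiv_class_iff[OF E(1), of b c] eq_equiv_class_iff[OF E(1), of c b] by auto
    have len: "length b = m" "length c = m" using b c D(1) by auto
    have "(b, c) \<notin> ?less" "(c, b) \<notin> ?less"
      using b c bc len by blast+
    \<comment> \<open>On lists of equal length \<open>lex\<close> and \<open>lenlex\<close> agree,
      and \<open>lenlex\<close> is total.\<close>
    moreover have "total (lenlex less_than)"
      by (rule total_lenlex) (simp add: total_less_than)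
    then have "b = c \<or> (b, c) \<in> lenlex less_than \<or> (c, b) \<in> lenlex less_than"
      unfolding total_on_def by blast
    ultimately show "b = c"
      using len by (simp add: lenlex_conv)
  next
    fix X assume "X \<in> (\<lambda>b. E `` {b}) ` ?D'"
    then show "X \<in> D // E" by (auto intro: quotientI)
  next
    fix X assume "X \<in> D // E"
    then obtain b where b: "b \<in> D" "X = E `` {b}" by (rule quotientE)
    then have "b \<in> X" using E(1) equiv_class_self by fastforce
    \<comment> \<open>Restricted to equal lengths the dictionary order is well-founded; across
      lengths it would not be.\<close>
    moreover have "wf ?less" by (intro wf_lex) simp
    ultimately obtain c where c: "c \<in> X" "\<And>d. (d, c) \<in> ?less \<Longrightarrow> d \<notin> X"
      by (metis wf_eq_minimal)
    have bc: "(b, c) \<in> E" using b c by simp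
    then have X: "X = E `` {c}" using b equiv_class_eq[OF E(1)] by blast
    have "c \<in> ?D'" using E_D(2)[OF bc] c(2) unfolding X by blast
    then show "X \<in> (\<lambda>b. E `` {b}) ` ?D'" using X by blast
  qed
qed

text \<open>The assumption on finite sets enters here: a single point takes \<open>k = 0\<close>, an
  infinite set is left to the classification. As the source is all of \<open>tuples k\<close>, the
  definable graph belongs to a total map, whose coordinates are therefore definable terms.\<close>

lemma definable_parametrization:
  assumes "definable m (\<lambda>x. x \<in> D)" "D \<subseteq> tuples m" "finite D \<Longrightarrow> card D = 1"
  obtains k g where "k \<le> m" "bij_betw g (tuples k) D" "dmap k m g"
proof -
  have "\<exists>k\<le>m. diso m D k (tuples k)"
  proof (cases "finite D")
    case True
    then obtain p where "D = {p}" using assms(3) card_1_singletonE by blast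
    then show ?thesis using diso_singleton[of p m] assms(2) by auto
  next
    case False
    then show ?thesis using tame_classification[OF tame_definable[OF assms(1,2)]] by blast
  qed
  then obtain k where k: "k \<le> m" "diso k (tuples k) m D" using diso_sym by blast
  then obtain g where g: "bij_betw g (tuples k) D"
    and R: "definable (k + m) (\<lambda>z. take k z \<in> tuples k \<and> g (take k z) = drop k z)"
    unfolding diso_def by blast
  have len: "length (g x) = m" if "length x = k" for x
    using bspec[OF bij_betwE[OF g], of x] assms(2) that by auto
  have "dterm k (\<lambda>x. g x ! i)" if i: "i < m" for i
    unfolding dterm_def
  proof -
    have "dmap (Suc k + m) (k + m) (\<lambda>z. take k z @ drop (Suc k) z)"
      by (intro dmap_append dmap_take dmap_drop) simp
    from definable_comp[OF R this]
    have "definable (Suc k + m) (\<lambda>z. g (take k z) = drop (Suc k) z)"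
      by (rule definable_congD) simp
    moreover have "definable (Suc k + m) (\<lambda>z. z ! k = z ! (Suc k + i))"
      using i by (intro definable_nth_eq) auto
    \<comment> \<open>A coordinate is extracted by quantifying over the whole value \<open>y\<close>
      and comparing its entry \<open>i\<close> with the entry at position \<open>k\<close>.\<close>
    ultimately have "definable (Suc k) (\<lambda>x. \<exists>y. length y = m \<and> g (take k (x @ y)) = drop (Suc k) (x @ y) \<and>
      (x @ y) ! k = (x @ y) ! (Suc k + i))"
      by (intro definable_ex definable_conj)
    then show "definable (Suc k) (\<lambda>x. x ! k = g (take k x) ! i)"
    proof (rule definable_congD)
      fix x :: "nat list" assume x: "length x = Suc k"
      have "g (take k (x @ y)) = drop (Suc k) (x @ y) \<and> (x @ y) ! k = (x @ y) ! (Suc k + i) \<longleftrightarrow>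
        y = g (take k x) \<and> x ! k = y ! i" for y
        using x nth_append_length_plus[of x y i] by (auto simp: nth_append)
      then show "(\<exists>y. length y = m \<and> g (take k (x @ y)) = drop (Suc k) (x @ y) \<and>
        (x @ y) ! k = (x @ y) ! (Suc k + i)) \<longleftrightarrow> x ! k = g (take k x) ! i"
        using len[of "take k x"] x by auto
    qed
  qed
  then have "dmap k m g" using len by (simp add: dmap_def)
  with k g that show ?thesis by blast
qed

section \<open>Pulling formulas back along a parametrization\<close>

text \<open>The number \<open>n\<close> of blocks is a separate argument, since for
  \<open>k = 0\<close> it cannot be recovered from the length of the list.\<close>

definition map_blocks :: "nat \<Rightarrow> (nat list \<Rightarrow> nat list) \<Rightarrow> nat \<Rightarrow> nat list \<Rightarrow> nat list" where
  "map_blocks k g n xs = concat (map (\<lambda>i. g (take k (drop (i * k) xs))) [0..<n])"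

lemma dmap_concat:
  "(\<And>i. i < n \<Longrightarrow> dmap l m (G i)) \<Longrightarrow> dmap l (n * m) (\<lambda>xs. concat (map (\<lambda>i. G i xs) [0..<n]))"
proof (induction n)
  case 0
  then show ?case by (simp add: dmap_Nil)
next
  case (Suc n)
  have "dmap l (n * m + m) (\<lambda>xs. concat (map (\<lambda>i. G i xs) [0..<n]) @ G n xs)"
    using Suc by (intro dmap_append) auto
  then show ?case by (simp add: add.commute)
qed

lemma dmap_map_blocks:
  assumes "dmap k m g"
  shows "dmap (n * k) (n * m) (map_blocks k g n)"
  unfolding map_blocks_def
proof (intro dmap_concat dmap_comp[OF assms] dmap_take_drop)
  fix i assume "i < n"
  then have "Suc i * k \<le> n * k" by (intro mult_le_mono1) simp
  then show "i * k + k \<le> n * k" by (simp add: add.commute)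
qed

lemma block_concat:
  assumes "\<forall>c\<in>set cs. length c = k" "i < length cs"
  shows "take k (drop (i * k) (concat cs)) = cs ! i"
  using assms
proof (induction cs arbitrary: i)
  case (Cons c cs)
  then show ?case by (cases i) simp_all
qed simp

lemma map_blocks_concat:
  assumes "\<forall>c\<in>set cs. length c = k" "length cs = n"
  shows "map_blocks k g n (concat cs) = concat (map g cs)"
proof -
  have "map (\<lambda>i. g (take k (drop (i * k) (concat cs)))) [0..<n] = map g cs"
    using assms by (intro nth_equalityI) (auto simp: block_concat)
  then show ?thesis by (simp add: map_blocks_def)
qed

lemma length_concat_eq: "\<forall>c\<in>set cs. length c = k \<Longrightarrow> length (concat cs) = length cs * k"
  by (induction cs) auto

lemma plus_fm_in_conj_list: "(\<And>\<phi>. \<phi> \<in> set \<phi>s \<Longrightarrow> plus_fm_in n \<phi>) \<Longrightarrow> plus_fm_in n (conj_list \<phi>s)"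
  by (induction \<phi>s rule: conj_list.induct) (auto simp: plus_fm_in_def)

text \<open>Composing with \<open>map_blocks\<close> lets a formula about values of \<open>g\<close>
  speak about their parameters; this supplies the predicates and functions of the new
  interpretation.\<close>

lemma pullback_formula:
  assumes "plus_fm_in (n * m) \<phi>" "dmap k m g"
  shows "\<exists>\<psi>. plus_fm_in (n * k) \<psi> \<and>
    (\<forall>cs. length cs = n \<and> set cs \<subseteq> tuples k \<longrightarrow> (holds \<psi> (concat cs) \<longleftrightarrow> holds \<phi> (concat (map g cs))))"
proof -
  from definable_comp[OF definable_holds[OF assms(1)] dmap_map_blocks[OF assms(2)]]
  obtain \<psi> where \<psi>: "plus_fm_in (n * k) \<psi>"
    "\<And>xs. length xs = n * k \<Longrightarrow> holds \<psi> xs \<longleftrightarrow> holds \<phi> (map_blocks k g n xs)"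
    unfolding definable_def by blast
  have "holds \<psi> (concat cs) \<longleftrightarrow> holds \<phi> (concat (map g cs))" if "length cs = n" "set cs \<subseteq> tuples k" for cs
  proof -
    have len: "\<forall>c\<in>set cs. length c = k" using that(2) by auto
    have "length (concat cs) = n * k" unfolding length_concat_eq[OF len] that(1) ..
    from \<psi>(2)[OF this] show ?thesis by (simp only: map_blocks_concat[OF len that(1)])
  qed
  with \<psi>(1) show ?thesis by blast
qed

text \<open>The last assumption excludes finite structures with several elements, for which
  \<open>finite_definably_isomorphic\<close> shows the conclusion to be impossible.\<close>

theorem theorem10:
  fixes \<Omega> :: "('f, 'p) signature" and U :: "('f, 'p) fm set"
    and \<iota> :: "('f, 'p) translation" and m :: nat
  assumes "theory_of \<Omega> U"
    and "interpretation_of TYPE('a) \<Omega> U \<iota>" and "dim \<iota> = m"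
    and "finite (dom_set \<iota> // eq_rel \<iota>) \<Longrightarrow> card (dom_set \<iota> // eq_rel \<iota>) = 1"
  shows "\<exists>m'\<le>m. \<exists>\<kappa> :: ('f, 'p) translation. dim \<kappa> = m' \<and>
           non_relative \<kappa> \<and> absolute_equality \<kappa> \<and>
           interpretation_of TYPE('a) \<Omega> U \<kappa> \<and> definably_isomorphic TYPE('a) \<Omega> \<iota> \<kappa>"
proof -
  from assms(2) obtain A :: "('a, 'f, 'p) struct" and h
    where A: "model_of \<Omega> U A" and h: "interprets_via \<Omega> \<iota> A h"
    unfolding interpretation_of_def interprets_def by blast
  let ?D = "dom_set \<iota>" and ?E = "eq_rel \<iota>"
  have tr: "plus_fm_in m (Dom \<iota>)" "plus_fm_in (2 * m) (PredEq \<iota>)"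
    "\<And>p. p \<in> preds \<Omega> \<Longrightarrow> plus_fm_in (pred_arity \<Omega> p * m) (Pred \<iota> p)"
    "\<And>f. f \<in> funs \<Omega> \<Longrightarrow> plus_fm_in (Suc (fun_arity \<Omega> f) * m) (Fun \<iota> f)"
    using h assms(3) by (auto simp: interprets_via_def translation_of_def)
  have equiv: "equiv ?D ?E" and bij_h: "bij_betw h (?D // ?E) (carrier A)"
    using h by (auto simp: interprets_via_def)
  have h_P: "pred_interp A p (map (\<lambda>b. h (eq_class \<iota> b)) bs) \<longleftrightarrow> holds (Pred \<iota> p) (concat bs)"
    if "p \<in> preds \<Omega>" "length bs = pred_arity \<Omega> p" "set bs \<subseteq> ?D" for p bs
    using h that unfolding interprets_via_def by blast
  have h_F: "h (eq_class \<iota> b0) = fun_interp A f (map (\<lambda>b. h (eq_class \<iota> b)) bs) \<longleftrightarrow>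
      holds (Fun \<iota> f) (concat (b0 # bs))"
    if "f \<in> funs \<Omega>" "b0 \<in> ?D" "length bs = fun_arity \<Omega> f" "set bs \<subseteq> ?D" for f b0 bs
    using h that unfolding interprets_via_def by blast
  have D: "?D \<subseteq> tuples m" using assms(3) by (auto simp: dom_set_def)
  have def_D: "definable m (\<lambda>x. x \<in> ?D)"
    by (rule definable_congD[OF definable_holds[OF tr(1)]]) (simp add: dom_set_def assms(3))
  have def_PredEq: "definable (m + m) (holds (PredEq \<iota>))"
    using definable_holds[OF tr(2)] by (simp add: mult_2)
  have "definable (m + m) (\<lambda>z. take m z \<in> ?D \<and> drop m z \<in> ?D \<and> holds (PredEq \<iota>) z)"
    by (intro definable_conj definable_comp[OF def_D] dmap_take dmap_drop def_PredEq) simp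
  then have def_E: "definable (m + m) (\<lambda>z. (take m z, drop m z) \<in> ?E)"
    by (rule definable_congD) (simp add: eq_rel_def)
  obtain D' where D': "D' \<subseteq> ?D" "definable m (\<lambda>x. x \<in> D')"
    and bij_D': "bij_betw (\<lambda>b. ?E `` {b}) D' (?D // ?E)"
    using definable_representatives[OF D def_D equiv def_E] by blast
  \<comment> \<open>A set of representatives has as many elements as the quotient, so the assumption
    carries over.\<close>
  have "finite D' \<Longrightarrow> card D' = 1"
    using assms(4) bij_betw_finite[OF bij_D'] bij_betw_same_card[OF bij_D'] by simp
  then obtain k g where k: "k \<le> m" and bij_g: "bij_betw g (tuples k) D'" and g: "dmap k m g"
    using definable_parametrization[OF D'(2)] D' D by blast
  have g_D: "g c \<in> ?D" if "c \<in> tuples k" for c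
    using bij_betwE[OF bij_g] D'(1) that by blast

  obtain P where P: "\<And>p. p \<in> preds \<Omega> \<Longrightarrow> plus_fm_in (pred_arity \<Omega> p * k) (P p) \<and>
    (\<forall>cs. length cs = pred_arity \<Omega> p \<and> set cs \<subseteq> tuples k \<longrightarrow>
      (holds (P p) (concat cs) \<longleftrightarrow> holds (Pred \<iota> p) (concat (map g cs))))"
    using pullback_formula[OF tr(3) g] by metis
  obtain F where F: "\<And>f. f \<in> funs \<Omega> \<Longrightarrow> plus_fm_in (Suc (fun_arity \<Omega> f) * k) (F f) \<and>
    (\<forall>cs. length cs = Suc (fun_arity \<Omega> f) \<and> set cs \<subseteq> tuples k \<longrightarrow>
      (holds (F f) (concat cs) \<longleftrightarrow> holds (Fun \<iota> f) (concat (map g cs))))"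
    using pullback_formula[OF tr(4) g] by metis
  define \<kappa> :: "('f, 'p) translation" where
    "\<kappa> = \<lparr>dim = k, Dom = Top, PredEq = conj_list (map (\<lambda>i. Eq (Var i) (Var (k + i))) [0..<k]), Pred = P, Fun = F\<rparr>"
  have [simp]: "dim \<kappa> = k" "Pred \<kappa> = P" "Fun \<kappa> = F" by (simp_all add: \<kappa>_def)
  have \<kappa>: "non_relative \<kappa>" "absolute_equality \<kappa>"
    by (simp_all add: \<kappa>_def non_relative_def absolute_equality_def)
  have dom_\<kappa>: "dom_set \<kappa> = tuples k"
    using dom_set_non_relative[OF \<kappa>(1)] by (auto simp: tuples_def)
  have class_\<kappa>: "eq_class \<kappa> c = {c}" if "c \<in> tuples k" for c
    using eq_rel_absolute_equality[OF \<kappa>(2)] that by (auto simp: dom_\<kappa>)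
  have translation_\<kappa>: "translation_of \<Omega> \<kappa>"
    unfolding translation_of_def
  proof (intro conjI ballI)
    show "plus_fm_in (2 * dim \<kappa>) (PredEq \<kappa>)"
      unfolding \<kappa>_def by simp (rule plus_fm_in_conj_list, auto simp: plus_fm_in_def)
  qed (use P F in \<open>auto simp: \<kappa>_def plus_fm_in_def\<close>)

  \<comment> \<open>The classes of \<open>\<kappa>\<close> are singletons; a tuple names the element
    that its image under \<open>g\<close> names in \<open>\<iota>\<close>.\<close>
  define h' where "h' X = h (eq_class \<iota> (g (the_elem X)))" for X
  have h'_class: "h' (eq_class \<kappa> c) = h (eq_class \<iota> (g c))" if "c \<in> tuples k" for c
    by (simp add: h'_def class_\<kappa>[OF that])
  have quot_\<kappa>: "dom_set \<kappa> // eq_rel \<kappa> = (\<lambda>c. {c}) ` tuples k"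
    using class_\<kappa> by (auto simp: quotient_def dom_\<kappa>)
  have "bij_betw the_elem (dom_set \<kappa> // eq_rel \<kappa>) (tuples k)"
    unfolding quot_\<kappa> by (auto simp: bij_betw_def inj_on_def image_image)
  \<comment> \<open>The chain leads from singleton classes to tuples, to representatives, to classes
    of \<open>\<iota>\<close>, to elements of \<open>A\<close>.\<close>
  from bij_betw_trans[OF bij_betw_trans[OF bij_betw_trans[OF this bij_g] bij_D'] bij_h]
  have bij_h': "bij_betw h' (dom_set \<kappa> // eq_rel \<kappa>) (carrier A)"
    by (simp add: h'_def[abs_def] o_def)
  have "interprets_via \<Omega> \<kappa> A h'"
    unfolding interprets_via_def
  proof (intro conjI ballI allI impI)
    show "struct_of \<Omega> A" using h by (simp add: interprets_via_def)
    have "replicate k 0 \<in> tuples k" by simp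
    then show "dom_set \<kappa> \<noteq> {}" unfolding dom_\<kappa> by blast
    show "equiv (dom_set \<kappa>) (eq_rel \<kappa>)"
      using eq_rel_absolute_equality[OF \<kappa>(2)] by (auto simp: equiv_def refl_on_def sym_def trans_def)
  next
    fix p cs assume p: "p \<in> preds \<Omega>" and cs: "length cs = pred_arity \<Omega> p \<and> set cs \<subseteq> dom_set \<kappa>"
    have "map (\<lambda>c. h' (eq_class \<kappa> c)) cs = map (\<lambda>b. h (eq_class \<iota> b)) (map g cs)"
      using cs h'_class by (auto simp: dom_\<kappa>)
    then have "pred_interp A p (map (\<lambda>c. h' (eq_class \<kappa> c)) cs) \<longleftrightarrow>
        pred_interp A p (map (\<lambda>b. h (eq_class \<iota> b)) (map g cs))"
      by (simp only:)
    also have "\<dots> \<longleftrightarrow> holds (Pred \<iota> p) (concat (map g cs))"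
      using cs g_D by (intro h_P p) (auto simp: dom_\<kappa>)
    also have "\<dots> \<longleftrightarrow> holds (Pred \<kappa> p) (concat cs)"
      using P[OF p] cs by (simp add: dom_\<kappa>)
    finally show "pred_interp A p (map (\<lambda>c. h' (eq_class \<kappa> c)) cs) \<longleftrightarrow> holds (Pred \<kappa> p) (concat cs)" .
  next
    fix f c0 cs
    assume f: "f \<in> funs \<Omega>"
      and cs: "c0 \<in> dom_set \<kappa> \<and> length cs = fun_arity \<Omega> f \<and> set cs \<subseteq> dom_set \<kappa>"
    have "map (\<lambda>c. h' (eq_class \<kappa> c)) cs = map (\<lambda>b. h (eq_class \<iota> b)) (map g cs)"
      using cs h'_class by (auto simp: dom_\<kappa>)
    moreover have "h' (eq_class \<kappa> c0) = h (eq_class \<iota> (g c0))"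
      using cs h'_class by (simp add: dom_\<kappa>)
    ultimately have "h' (eq_class \<kappa> c0) = fun_interp A f (map (\<lambda>c. h' (eq_class \<kappa> c)) cs) \<longleftrightarrow>
        h (eq_class \<iota> (g c0)) = fun_interp A f (map (\<lambda>b. h (eq_class \<iota> b)) (map g cs))"
      by (simp only:)
    also have "\<dots> \<longleftrightarrow> holds (Fun \<iota> f) (concat (g c0 # map g cs))"
      using cs g_D by (intro h_F f) (auto simp: dom_\<kappa>)
    also have "\<dots> \<longleftrightarrow> holds (Fun \<iota> f) (concat (map g (c0 # cs)))"
      by simp
    also have "\<dots> \<longleftrightarrow> holds (Fun \<kappa> f) (concat (c0 # cs))"
    proof -
      have "length (c0 # cs) = Suc (fun_arity \<Omega> f) \<and> set (c0 # cs) \<subseteq> tuples k"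
        using cs by (auto simp: dom_\<kappa>)
      with F[OF f] show ?thesis unfolding \<open>Fun \<kappa> = F\<close> by blast
    qed
    finally show "h' (eq_class \<kappa> c0) = fun_interp A f (map (\<lambda>c. h' (eq_class \<kappa> c)) cs) \<longleftrightarrow>
        holds (Fun \<kappa> f) (concat (c0 # cs))" .
  qed (fact translation_\<kappa> bij_h')+
  moreover have "definable (m + k) (\<lambda>z. holds (PredEq \<iota>) (take m z @ g (drop m z)))"
    \<comment> \<open>The isomorphism relates \<open>b\<close> to \<open>c\<close> exactly if
      \<open>b\<close> is equivalent to \<open>g c\<close>, which the equality formula of
      \<open>\<iota>\<close> expresses.\<close>
    by (intro definable_comp[OF def_PredEq] dmap_append dmap_take dmap_comp[OF g] dmap_drop) simp
  then obtain I where I: "plus_fm_in (m + k) I"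
    "\<And>z. length z = m + k \<Longrightarrow> holds I z \<longleftrightarrow> holds (PredEq \<iota>) (take m z @ g (drop m z))"
    unfolding definable_def by blast
  have "h (eq_class \<iota> b) = h' (eq_class \<kappa> c) \<longleftrightarrow> holds I (b @ c)"
    if b: "b \<in> ?D" and "c \<in> dom_set \<kappa>" for b c
  proof -
    have c: "c \<in> tuples k" using that by (simp add: dom_\<kappa>)
    have "h (eq_class \<iota> b) = h (eq_class \<iota> (g c)) \<longleftrightarrow> eq_class \<iota> b = eq_class \<iota> (g c)"
      using inj_on_eq_iff[OF bij_betw_imp_inj_on[OF bij_h]] b g_D[OF c] by (simp add: quotientI)
    also have "\<dots> \<longleftrightarrow> (b, g c) \<in> ?E"
      using eq_equiv_class_iff[OF equiv b g_D[OF c]] .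
    also have "\<dots> \<longleftrightarrow> holds I (b @ c)"
      using b c D g_D[OF c] I(2)[of "b @ c"] by (auto simp: eq_rel_def)
    finally show ?thesis using h'_class[OF c] by simp
  qed
  with h \<open>interprets_via \<Omega> \<kappa> A h'\<close> I(1) assms(3) have "defines_isomorphism \<Omega> A I \<iota> \<kappa>"
    unfolding defines_isomorphism_def by auto
  ultimately show ?thesis
    using k \<kappa> A unfolding interpretation_of_def interprets_def definably_isomorphic_def
    by (intro exI[of _ k] conjI exI[of _ \<kappa>]) auto
qed

end
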